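(* Let $\Omega\subset\mathbb{C}^2$ be a bounded convex domain and let $p\in\partial\Omega$. If $\partial\Omega$ is smooth in a neighborhood of $p$ and $\lim_{\Omega\ni z\to p}T_{\Omega}(z)=1$, then there exists a neighborhood $U$ of $p$ such that $\partial\Omega$ is Levi flat at every $q\in\partial\Omega\cap U$.
   Context: Squeezing function corresponding to the polydisk: let $\mathbb{D}^n$ be the unit polydisk in $\mathbb{C}^n$ and $D_r(0)=\{w\in\mathbb{C}^n:|w_i|<r,\ i=1,\dots,n\}$. For a bounded domain $\Omega\subset\mathbb{C}^n$ and $z\in\Omega$, $T_\Omega(z)$ is the supremum of all $r>0$ for which there exists an injective holomorphic map $f:\Omega\to\mathbb{D}^n$ with $f(z)=0$ and $D_r(0)\subset f(\Omega)$. Levi flatness: if near a boundary point $q$ the domain $\Omega\subset\mathbb{C}^n$ is given by $\{\rho<0\}$ with $\rho$ real-valued, at least $C^2$-smooth, $\rho(q)=0$ and $\operatorname{grad}\rho(q)\neq0$, then $\partial\Omega$ is Levi flat at $q$ if $\sum_{i,j=1}^n\frac{\partial^2\rho}{\partial z_i\partial\overline{z}_j}(q)w_i\overline{w}_j=0$ for every $w=(w_1,\dots,w_n)\in\mathbb{C}^n$ with $\sum_{i=1}^n\frac{\partial\rho}{\partial z_i}(q)w_i=0$. *)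

theory Defs
  imports "HOL-Analysis.Analysis"
begin

definition polydisk :: "real \<Rightarrow> (complex ^ 'n) set" where
  "polydisk r = {w. \<forall>i. cmod (w $ i) < r}"

text \<open>A map is holomorphic when its (real) Frechet derivative exists and is complex linear.\<close>

definition holomorphic_map_on :: "(complex ^ 'n \<Rightarrow> complex ^ 'm) \<Rightarrow> (complex ^ 'n) set \<Rightarrow> bool" where
  "holomorphic_map_on f \<Omega> \<longleftrightarrow>
     (\<forall>z\<in>\<Omega>. \<exists>L. (f has_derivative L) (at z) \<and> (\<forall>c v. L (c *s v) = c *s L v))"

text \<open>For a bounded domain and a point of it, the set below is nonempty and bounded above by 1,
  so the real supremum is the genuine one.\<close>

definition squeezing_polydisk :: "(complex ^ 'n) set \<Rightarrow> complex ^ 'n \<Rightarrow> real" where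
  "squeezing_polydisk \<Omega> z =
     Sup {r. 0 < r \<and> (\<exists>f :: complex ^ 'n \<Rightarrow> complex ^ 'n.
            holomorphic_map_on f \<Omega> \<and> inj_on f \<Omega> \<and> f ` \<Omega> \<subseteq> polydisk 1 \<and>
            f z = 0 \<and> polydisk r \<subseteq> f ` \<Omega>)}"

text \<open>Class \<open>C\<^sup>k\<close> on an open set.\<close>

fun Ck_on :: "nat \<Rightarrow> 'a::euclidean_space set \<Rightarrow> ('a \<Rightarrow> real) \<Rightarrow> bool" where
  "Ck_on 0 U f \<longleftrightarrow> continuous_on U f"
| "Ck_on (Suc k) U f \<longleftrightarrow>
     (\<forall>x\<in>U. f differentiable (at x)) \<and> (\<forall>v. Ck_on k U (\<lambda>x. frechet_derivative f (at x) v))"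

definition local_defining_function ::
  "(complex ^ 'n) set \<Rightarrow> complex ^ 'n \<Rightarrow> (complex ^ 'n) set \<Rightarrow> (complex ^ 'n \<Rightarrow> real) \<Rightarrow> bool" where
  "local_defining_function \<Omega> q V \<rho> \<longleftrightarrow>
     open V \<and> q \<in> V \<and> Ck_on 2 V \<rho> \<and> \<Omega> \<inter> V = {z \<in> V. \<rho> z < 0} \<and>
     \<rho> q = 0 \<and> frechet_derivative \<rho> (at q) \<noteq> (\<lambda>v. 0)"

text \<open>Smoothness of the boundary is read as class \<open>C\<^sup>2\<close>, the regularity that the Levi form needs;
  it includes all higher classes and \<open>C\<^sup>\<infinity>\<close>.\<close>

definition smooth_boundary_near :: "(complex ^ 'n) set \<Rightarrow> complex ^ 'n \<Rightarrow> bool" where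
  "smooth_boundary_near \<Omega> p \<longleftrightarrow>
     (\<exists>U. open U \<and> p \<in> U \<and> (\<forall>q\<in>frontier \<Omega> \<inter> U. \<exists>V \<rho>. local_defining_function \<Omega> q V \<rho>))"

text \<open>The Wirtinger derivatives \<open>\<partial>/\<partial>z\<^sub>i = (\<partial>/\<partial>x\<^sub>i - \<i> \<partial>/\<partial>y\<^sub>i)/2\<close> and
  \<open>(\<partial>/\<partial>x\<^sub>i + \<i> \<partial>/\<partial>y\<^sub>i)/2\<close>: the directions of \<open>x\<^sub>i\<close> and \<open>y\<^sub>i\<close> are \<open>axis i 1\<close> and \<open>axis i \<i>\<close>.\<close>

definition wirtinger_z ::
  "'n \<Rightarrow> (complex ^ 'n \<Rightarrow> complex) \<Rightarrow> complex ^ 'n \<Rightarrow> complex" where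
  "wirtinger_z i f x =
     (frechet_derivative f (at x) (axis i 1) - \<i> * frechet_derivative f (at x) (axis i \<i>)) / 2"

definition wirtinger_zbar ::
  "'n \<Rightarrow> (complex ^ 'n \<Rightarrow> complex) \<Rightarrow> complex ^ 'n \<Rightarrow> complex" where
  "wirtinger_zbar i f x =
     (frechet_derivative f (at x) (axis i 1) + \<i> * frechet_derivative f (at x) (axis i \<i>)) / 2"

definition levi_form :: "(complex ^ 'n \<Rightarrow> real) \<Rightarrow> complex ^ 'n \<Rightarrow> complex ^ 'n \<Rightarrow> complex" where
  "levi_form \<rho> q w =
     (\<Sum>i\<in>UNIV. \<Sum>j\<in>UNIV.
        wirtinger_z i (wirtinger_zbar j (\<lambda>z. complex_of_real (\<rho> z))) q * w $ i * cnj (w $ j))"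

text \<open>The vanishing condition does not depend on the choice of the defining function, so asking
  for one such function is the usual notion; it also keeps the notion from holding vacuously where
  there is none.\<close>

definition levi_flat_at :: "(complex ^ 'n) set \<Rightarrow> complex ^ 'n \<Rightarrow> bool" where
  "levi_flat_at \<Omega> q \<longleftrightarrow>
     (\<exists>V \<rho>. local_defining_function \<Omega> q V \<rho> \<and>
        (\<forall>w. (\<Sum>i\<in>UNIV. wirtinger_z i (\<lambda>z. complex_of_real (\<rho> z)) q * w $ i) = 0 \<longrightarrow>
             levi_form \<rho> q w = 0))"

end

(*
  Suppose the Levi form at a boundary point q near p does not vanish. Convexity makes it positive, so
  suitable affine coordinates and the substitution x1 - beta x2^2 identify Omega near q, after the
  dilation (x1, x2) -> (x1 / t, x2 / sqrt t), with the Siegel domain Re w > |x2|^2, that is, with the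
  unit ball. A map f of Omega into the bidisk whose image contains a bidisk of radius close to 1 and
  which sends the base point (t, 0) to 0 turns the infinitesimal ball into a set close to a bidisk:
  holomorphic disks in the ball bound Df from above, and functionals of the Cayley coordinates, composed
  with the inverse of f, bound it from below. A norm close to the sup norm violates the parallelogram
  law, whence T(q + t n) is bounded away from 1 by a universal constant as t -> 0.

  The lower bound is local although the functionals are bounded only near q: by convexity x1 has
  nonnegative real part on Omega, and so has x1 - theta beta x2^2 + O(t) for some theta > 0; Harnack's
  inequality then confines the preimage of a slightly smaller bidisk to |x1| = O(t), |x2|^2 = O(t).

  Holomorphy of the inverse of f is avoided. On a complex line in the image, k = h o f^-1 and the
  Jacobian F of f at the preimage are continuous, and holomorphic where F is nonzero. Applying the
  maximum principle on this open set to (k / l)^N F and letting N tend to infinity gives the Schwarz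
  lemma at regular values, which are dense by Sard's theorem.
*)
theory Submission
  imports Defs "HOL-Complex_Analysis.Conformal_Mappings"
begin

text \<open>The limit is used in the form \<open>98 / 100 < squeezing_polydisk \<Omega> z\<close>
  for the points of \<open>\<Omega>\<close> in one ball about \<open>p\<close>. A fixed threshold
  rather than a limit is what can be transported to the other boundary points \<open>q\<close> of
  the ball. The map \<open>f\<close> furnished by the supremum changes with \<open>z\<close>, and
  nothing is known of it beyond injectivity, holomorphy and two inclusions; so every constant and
  every smallness condition on \<open>t\<close> has to depend on the domain alone. The dilation is
  never carried out: the sizes \<open>t\<close> and \<open>sqrt t\<close> are kept in the estimates,
  and no limit of domains or of maps is formed. The radii 98/100, 95/100 and 9/10 are spent one
  after the other: the first gap bounds the coordinate transversal to the boundary, the second gap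
  the tangential one, and the last bidisk carries the comparison of norms. The resulting factors
  11/9 and 10/9 are incompatible because \<open>4 * (9/10)^2\<close> exceeds
  \<open>2 * (11/9)^2\<close>.\<close>

no_notation fps_nth (infixl \<open>$\<close> 75)

section \<open>Holomorphic functions and their directional derivatives\<close>

text \<open>A frontier point of \<open>W\<close> inside the disk is a zero of \<open>F\<close>, so
  the factor \<open>F\<close> kills the product exactly where \<open>k\<close> is not under control;
  on the unit circle \<open>M\<close> takes over. Powers of the quotient make the fixed value
  \<open>F l0\<close> irrelevant in the limit.\<close>

lemma Schwarz_off_zeros:
  fixes F k :: "complex \<Rightarrow> complex"
  assumes contF: "continuous_on (cball 0 1) F" and contk: "continuous_on (cball 0 1) k"
    and holF: "F holomorphic_on {l \<in> ball 0 1. F l \<noteq> 0}"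
    and holk: "k holomorphic_on {l \<in> ball 0 1. F l \<noteq> 0}"
    and F0: "F 0 \<noteq> 0" and k0: "k 0 = 0"
    and M: "\<And>l. cmod l = 1 \<Longrightarrow> cmod (k l) \<le> M"
    and l0: "cmod l0 < 1" "F l0 \<noteq> 0"
  shows "cmod (k l0) \<le> M * cmod l0"
proof -
  define W where "W = {l \<in> ball 0 1. F l \<noteq> 0}"
  have oW: "open W"
  proof -
    have "open (ball 0 1 \<inter> F -` (- {0}))"
      by (rule continuous_open_preimage)
         (auto intro: continuous_on_subset[OF contF])
    moreover have "W = ball 0 1 \<inter> F -` (- {0})" by (auto simp: W_def)
    ultimately show ?thesis by simp
  qed
  have W0: "0 \<in> W" using F0 by (simp add: W_def)
  \<comment> \<open>Since \<open>F 0\<close> is nonzero, \<open>k\<close> is holomorphic near 0 and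
    the singularity of the quotient there is removable.\<close>
  define \<phi> where "\<phi> = (\<lambda>l. if l = 0 then deriv k 0 else (k l - k 0) / (l - 0))"
  have hol\<phi>: "\<phi> holomorphic_on W"
    unfolding \<phi>_def
    by (rule pole_lemma) (use holk W0 oW in \<open>auto simp: W_def interior_open\<close>)
  have cont\<phi>: "continuous_on (cball 0 1) \<phi>"
  proof -
    have "isCont \<phi> 0"
      using hol\<phi> oW W0 holomorphic_on_imp_continuous_on continuous_on_eq_continuous_at by blast
    then have "continuous (at 0 within cball 0 1) \<phi>"
      by (rule continuous_at_imp_continuous_at_within)
    moreover have "continuous (at x within cball 0 1) \<phi>" if "x \<in> cball 0 1" "x \<noteq> 0" for x
    proof (rule continuous_transform_within)
      show "continuous (at x within cball 0 1) (\<lambda>l. k l / l)"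
        using contk that by (auto intro!: continuous_intros simp: continuous_on_eq_continuous_within)
      show "0 < cmod x" using that by simp
      show "k l / l = \<phi> l" if "dist l x < cmod x" for l
        using that by (auto simp: \<phi>_def k0)
    qed (use that in auto)
    ultimately show ?thesis
      unfolding continuous_on_eq_continuous_within by metis
  qed
  obtain B where B: "B > 0" "\<And>l. l \<in> cball 0 1 \<Longrightarrow> cmod (F l) \<le> B"
  proof -
    have "bounded (F ` cball 0 1)"
      by (intro compact_imp_bounded compact_continuous_image contF) auto
    then show ?thesis using that by (auto simp: bounded_pos)
  qed
  have M0: "0 \<le> M" using M[of 1] by (meson norm_ge_zero norm_one order_trans)
  have clW: "closure W \<subseteq> cball 0 1"
    by (rule closure_minimal) (auto simp: W_def)
  have main: "cmod (\<phi> l0 ^ N * F l0) \<le> M ^ N * B" for N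
  proof (rule maximum_modulus_frontier[where S = W and f = "\<lambda>l. \<phi> l ^ N * F l" and \<xi> = l0])
    show "(\<lambda>l. \<phi> l ^ N * F l) holomorphic_on interior W"
      using hol\<phi> holF oW by (auto simp: interior_open W_def intro!: holomorphic_intros)
    show "continuous_on (closure W) (\<lambda>l. \<phi> l ^ N * F l)"
      by (intro continuous_intros continuous_on_subset[OF cont\<phi> clW] continuous_on_subset[OF contF clW])
    show "bounded W" by (rule bounded_subset[of "ball 0 1"]) (auto simp: W_def)
    show "l0 \<in> W" using l0 by (simp add: W_def)
    fix z assume z: "z \<in> frontier W"
    then have zc: "z \<in> cball 0 1" and zn: "z \<notin> W"
      using clW oW by (auto simp: frontier_def interior_open)
    show "cmod (\<phi> z ^ N * F z) \<le> M ^ N * B"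
    proof (cases "F z = 0")
      case True then show ?thesis using M0 B by simp
    next
      case False
      then have nz: "cmod z = 1" using zc zn by (auto simp: W_def)
      then have "z \<noteq> 0" by auto
      then have "cmod (\<phi> z) = cmod (k z)" by (simp add: \<phi>_def k0 norm_divide nz)
      then have "cmod (\<phi> z) \<le> M" using M nz by simp
      then show ?thesis
        using B(2)[OF zc] M0 by (auto simp: norm_mult norm_power intro!: mult_mono power_mono)
    qed
  qed
  have "cmod (\<phi> l0) \<le> M"
  proof (rule ccontr)
    assume "\<not> cmod (\<phi> l0) \<le> M"
    then have c: "M < cmod (\<phi> l0)" by simp
    \<comment> \<open>With ratio \<open>x < 1\<close> the bound \<open>x ^ N * B\<close> would force
      \<open>F l0 = 0\<close>.\<close>
    define x where "x = M / cmod (\<phi> l0)"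
    have p: "0 < cmod (\<phi> l0)" using c M0 by linarith
    have x: "0 \<le> x" "x < 1" using c M0 p by (auto simp: x_def)
    have "cmod (F l0) \<le> x ^ N * B" for N
      using main[of N] p by (simp add: x_def norm_mult norm_power field_simps)
    moreover have "(\<lambda>N. x ^ N * B) \<longlonglongrightarrow> 0 * B"
      by (intro tendsto_mult tendsto_const LIMSEQ_realpow_zero x)
    ultimately have "cmod (F l0) \<le> 0 * B"
      by (intro LIMSEQ_le_const[of "\<lambda>N. x ^ N * B"]) auto
    then show False using l0 by simp
  qed
  then show ?thesis
    by (cases "l0 = 0") (auto simp: \<phi>_def k0 norm_divide field_simps)
qed

section \<open>Cauchy's formula along complex lines and holomorphy of derivatives\<close>

definition holomorphic_fun_on :: "(complex ^ 'n \<Rightarrow> complex) \<Rightarrow> (complex ^ 'n) set \<Rightarrow> bool" where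
  "holomorphic_fun_on u S \<longleftrightarrow>
     (\<forall>z\<in>S. \<exists>L. (u has_derivative L) (at z) \<and> (\<forall>c v. L (c *s v) = c * L v))"

lemma bounded_linear_vector_smult: "bounded_linear (\<lambda>c::complex. c *s (v :: complex ^ 'n))"
  unfolding linear_conv_bounded_linear[symmetric]
  by (rule linearI) (auto simp: vec_eq_iff algebra_simps)

lemmas continuous_on_vector_smult [continuous_intros] =
  bounded_linear.continuous_on[OF bounded_linear_vector_smult]
lemmas tendsto_vector_smult [tendsto_intros] =
  bounded_linear.tendsto[OF bounded_linear_vector_smult]
lemmas has_derivative_vector_smult [derivative_intros] =
  bounded_linear.has_derivative[OF bounded_linear_vector_smult]

lemma norm_vector_smult: "norm (c *s v) = cmod c * norm (v :: complex ^ 'n)"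
  by (simp add: norm_vec_def norm_mult L2_set_right_distrib)

lemma vector_smult_of_real: "complex_of_real r *s v = r *\<^sub>R (v :: complex ^ 'n)"
  by (simp only: vec_eq_iff vector_smult_component vector_scaleR_component) (simp add: scaleR_conv_of_real)

lemma has_field_derivative_along_curve:
  fixes u :: "complex ^ 'n \<Rightarrow> complex" and c :: "complex \<Rightarrow> complex ^ 'n"
  assumes "(u has_derivative L) (at (c l))" "\<And>a v. L (a *s v) = a * L v"
    and "(c has_derivative (\<lambda>h. h *s w)) (at l)"
  shows "((\<lambda>l. u (c l)) has_field_derivative L w) (at l)"
proof -
  have "((\<lambda>l. u (c l)) has_derivative (\<lambda>h. L (h *s w))) (at l)"
    using has_derivative_compose[OF assms(3,1)] .
  then show ?thesis
    by (simp add: assms(2) has_field_derivative_def mult_commute_abs)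
qed

lemma has_derivative_affine_line:
  "((\<lambda>l::complex. x + l *s v) has_derivative (\<lambda>h. h *s (v :: complex ^ 'n))) (at l)"
  by (auto intro!: derivative_eq_intros)

text \<open>Cauchy's formula on the slice through \<open>x\<close> in direction \<open>v\<close>.
  The parameter runs over a fixed interval, so that the dependence on \<open>x\<close> can be
  studied under the integral sign.\<close>

lemma derivative_eq_circle_integral:
  fixes u :: "complex ^ 'n \<Rightarrow> complex"
  assumes u: "holomorphic_fun_on u (ball x R)" and r: "0 < r" "r * norm v < R"
    and L: "(u has_derivative L) (at x)" "\<And>a v. L (a *s v) = a * L v"
  shows "L v = integral {0..1} (\<lambda>t. u (x + (of_real r * exp (2 * of_real pi * \<i> * of_real t)) *s v)
                  / (of_real r * exp (2 * of_real pi * \<i> * of_real t)))"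
proof -
  let ?f = "\<lambda>l. u (x + l *s v)"
  have diff: "?f field_differentiable at l" if "cmod l * norm v < R" for l
  proof -
    have "x + l *s v \<in> ball x R" using that by (simp add: dist_norm norm_vector_smult)
    then obtain L where "(u has_derivative L) (at (x + l *s v))" "\<And>a v. L (a *s v) = a * L v"
      using u unfolding holomorphic_fun_on_def by blast
    then show ?thesis
      using has_field_derivative_along_curve[OF _ _ has_derivative_affine_line]
      unfolding field_differentiable_def by blast
  qed
  have small: "cmod l * norm v < R" if "cmod l \<le> r" for l
    using mult_right_mono[OF that norm_ge_zero[of v]] r(2) by linarith
  have hol: "?f holomorphic_on ball 0 r"
    unfolding holomorphic_on_def
    by (rule ballI, rule field_differentiable_at_within, rule diff, rule small) simp
  have cont: "continuous_on (cball 0 r) ?f"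
    by (intro continuous_at_imp_continuous_on ballI field_differentiable_imp_continuous_at diff small) simp
  have "deriv ?f 0 = L v"
    by (rule DERIV_imp_deriv) (rule has_field_derivative_along_curve[OF _ L(2) has_derivative_affine_line], simp add: L)
  moreover have "((\<lambda>l. ?f l / (l - 0) ^ Suc 1) has_contour_integral 2 * pi * \<i> / fact 1 * (deriv ^^ 1) ?f 0) (circlepath 0 r)"
    by (rule Cauchy_has_contour_integral_higher_derivative_circlepath) (use hol cont r in auto)
  ultimately have "((\<lambda>l. ?f l / l ^ 2) has_contour_integral 2 * pi * \<i> * L v) (circlepath 0 r)"
    by (simp add: numeral_2_eq_2)
  then have "((\<lambda>t. ?f (circlepath 0 r t) / (circlepath 0 r t)\<^sup>2 *
      vector_derivative (circlepath 0 r) (at t within {0..1})) has_integral 2 * pi * \<i> * L v) {0..1}"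
    by (simp add: has_contour_integral_def)
  \<comment> \<open>On the circle \<open>dl = 2 pi i l dt\<close>: one power of \<open>l\<close> in
    the denominator cancels, and so does the constant in Cauchy's formula.\<close>
  moreover have "vector_derivative (circlepath 0 r) (at t within {0..1}) = 2 * pi * \<i> * circlepath 0 r t"
      "circlepath 0 r t \<noteq> 0" if "t \<in> {0..1}" for t
    using that r by (simp_all add: vector_derivative_circlepath01) (simp_all add: circlepath)
  ultimately have "((\<lambda>t. (2 * pi * \<i>) * (?f (circlepath 0 r t) / circlepath 0 r t)) has_integral 2 * pi * \<i> * L v) {0..1}"
    by (elim has_integral_eq[rotated]) (simp add: power2_eq_square)
  then have "((\<lambda>t. (2 * pi * \<i>) * (u (x + (of_real r * exp (2 * of_real pi * \<i> * of_real t)) *s v)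
                  / (of_real r * exp (2 * of_real pi * \<i> * of_real t)))) has_integral 2 * pi * \<i> * L v) {0..1}"
    by (simp add: circlepath)
  from has_integral_mult_right[OF this, of "inverse (2 * pi * \<i>)"]
  have "((\<lambda>t. u (x + (of_real r * exp (2 * of_real pi * \<i> * of_real t)) *s v)
                  / (of_real r * exp (2 * of_real pi * \<i> * of_real t))) has_integral L v) {0..1}"
    by (simp add: field_simps)
  then show ?thesis by (rule integral_unique[symmetric])
qed


lemma holomorphic_fun_on_subset:
  "holomorphic_fun_on u S \<Longrightarrow> T \<subseteq> S \<Longrightarrow> holomorphic_fun_on u T"
  by (auto simp: holomorphic_fun_on_def)

lemma holomorphic_fun_on_imp_continuous_on:
  "holomorphic_fun_on u S \<Longrightarrow> continuous_on S u"
  unfolding holomorphic_fun_on_def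
  by (meson continuous_at_imp_continuous_on has_derivative_continuous)

lemma holomorphic_fun_on_frechet:
  assumes "holomorphic_fun_on u S" "x \<in> S"
  shows "(u has_derivative frechet_derivative u (at x)) (at x)"
    and "frechet_derivative u (at x) (a *s v) = a * frechet_derivative u (at x) v"
proof -
  obtain L where L: "(u has_derivative L) (at x)" "\<And>a v. L (a *s v) = a * L v"
    using assms unfolding holomorphic_fun_on_def by blast
  then have "frechet_derivative u (at x) = L" by (metis frechet_derivative_at)
  then show "(u has_derivative frechet_derivative u (at x)) (at x)"
    and "frechet_derivative u (at x) (a *s v) = a * frechet_derivative u (at x) v"
    using L by auto
qed

lemma circle_in_ball:
  fixes v :: "complex ^ 'n"
  assumes "x \<in> ball z R" "r * norm v \<le> R" "0 < r"
  shows "x + (of_real r * exp (2 * of_real pi * \<i> * of_real t)) *s v \<in> ball z (2 * R)"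
proof -
  have "dist z (x + (of_real r * exp (2 * of_real pi * \<i> * of_real t)) *s v)
      \<le> dist z x + norm ((of_real r * exp (2 * of_real pi * \<i> * of_real t)) *s v)"
    by (metis add_diff_cancel_left' dist_norm dist_triangle norm_minus_commute)
  also have "\<dots> < R + R"
    using assms by (simp add: norm_vector_smult norm_mult)
  finally show ?thesis by simp
qed

text \<open>The three radii leave room: centres vary in the ball of radius \<open>R\<close>, the
  circles stay within \<open>2 * R\<close>, and the ball of radius \<open>2 * R\<close> about each
  centre lies in the domain of holomorphy.\<close>

lemma circle_integral_representation:
  fixes u :: "complex ^ 'n \<Rightarrow> complex"
  assumes u: "holomorphic_fun_on u (ball z (3 * R))" and R: "0 < r" "r * norm v \<le> R" "0 < R"
    and x: "x \<in> ball z R"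
  shows "frechet_derivative u (at x) v =
     integral {0..1} (\<lambda>t. u (x + (of_real r * exp (2 * of_real pi * \<i> * of_real t)) *s v)
                  / (of_real r * exp (2 * of_real pi * \<i> * of_real t)))"
proof (rule derivative_eq_circle_integral)
  have sub: "ball x (2 * R) \<subseteq> ball z (3 * R)"
  proof
    fix y assume "y \<in> ball x (2 * R)"
    then show "y \<in> ball z (3 * R)"
      using x dist_triangle[of z y x] by simp
  qed
  show "holomorphic_fun_on u (ball x (2 * R))"
    by (rule holomorphic_fun_on_subset[OF u sub])
  have "x \<in> ball z (3 * R)" using x R by simp
  from holomorphic_fun_on_frechet[OF u this]
  show "(u has_derivative frechet_derivative u (at x)) (at x)"
    and "\<And>a v. frechet_derivative u (at x) (a *s v) = a * frechet_derivative u (at x) v" .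
qed (use R in auto)

lemma exists_circle_radius:
  fixes v :: "complex ^ 'n"
  assumes "open S" "z \<in> S"
  obtains r R where "0 < r" "0 < R" "r * norm v \<le> R" "ball z (3 * R) \<subseteq> S"
proof -
  obtain e where e: "0 < e" "ball z e \<subseteq> S" using assms open_contains_ball by blast
  show ?thesis
  proof
    show "0 < e / 3 / (norm v + 1)" "0 < e / 3" using e by (auto intro!: divide_pos_pos add_nonneg_pos)
    have "e / 3 / (norm v + 1) * norm v = e / 3 * (norm v / (norm v + 1))" by simp
    also have "\<dots> \<le> e / 3 * 1"
      using e(1) by (intro mult_left_mono) (auto simp: divide_le_eq_1 add_nonneg_pos)
    finally show "e / 3 / (norm v + 1) * norm v \<le> e / 3" by simp
    show "ball z (3 * (e / 3)) \<subseteq> S" using e by simp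
  qed
qed

text \<open>Holomorphy asks only for a pointwise derivative. The circle integral contains
  \<open>u\<close> alone, which is continuous, so the derivative depends continuously on the point.
  The Leibniz rule in the next lemma relies on this.\<close>

lemma continuous_on_frechet_holomorphic_fun:
  fixes u :: "complex ^ 'n \<Rightarrow> complex"
  assumes u: "holomorphic_fun_on u S" and S: "open S"
  shows "continuous_on S (\<lambda>x. frechet_derivative u (at x) v)"
proof (rule continuous_at_imp_continuous_on, rule ballI)
  fix z assume z: "z \<in> S"
  then obtain r R where rR: "0 < r" "0 < R" "r * norm v \<le> R" "ball z (3 * R) \<subseteq> S"
    using exists_circle_radius[OF S] by blast
  have uR: "holomorphic_fun_on u (ball z (3 * R))"
    using u rR(4) by (rule holomorphic_fun_on_subset)
  have cu: "continuous_on (ball z (2 * R)) u"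
    using holomorphic_fun_on_imp_continuous_on[OF uR] rR
    by (elim continuous_on_subset) auto
  have "continuous_on (ball z R) (\<lambda>x. integral (cbox 0 1) (\<lambda>t::real.
          u (x + (of_real r * exp (2 * of_real pi * \<i> * of_real t)) *s v)
             / (of_real r * exp (2 * of_real pi * \<i> * of_real t))))"
  proof (rule integral_continuous_on_param)
    have "continuous_on (ball z R \<times> cbox 0 1) (\<lambda>p. u (fst p + (of_real r * exp (2 * of_real pi * \<i> * of_real (snd p))) *s v)
             / (of_real r * exp (2 * of_real pi * \<i> * of_real (snd p :: real))))"
      using circle_in_ball rR
      by (intro continuous_intros continuous_on_compose2[OF cu]) auto
    then show "continuous_on (ball z R \<times> cbox 0 1) (\<lambda>(x, t::real).
          u (x + (of_real r * exp (2 * of_real pi * \<i> * of_real t)) *s v)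
             / (of_real r * exp (2 * of_real pi * \<i> * of_real t)))"
      by (simp add: case_prod_beta')
  qed
  then have "continuous_on (ball z R) (\<lambda>x. frechet_derivative u (at x) v)"
    by (rule continuous_on_eq)
       (simp add: circle_integral_representation[OF uR rR(1,3,2)])
  then show "isCont (\<lambda>x. frechet_derivative u (at x) v) z"
    using rR(2) by (auto simp: continuous_on_eq_continuous_at)
qed

text \<open>This makes the Jacobian determinant holomorphic. Differentiation under the circle
  integral preserves complex linearity.\<close>

lemma holomorphic_fun_on_directional_derivative:
  fixes u :: "complex ^ 'n \<Rightarrow> complex"
  assumes u: "holomorphic_fun_on u S" and S: "open S"
  shows "holomorphic_fun_on (\<lambda>x. frechet_derivative u (at x) v) S"
  unfolding holomorphic_fun_on_def
proof
  fix z assume z: "z \<in> S"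
  then obtain r R where rR: "0 < r" "0 < R" "r * norm v \<le> R" "ball z (3 * R) \<subseteq> S"
    using exists_circle_radius[OF S] by blast
  define e where "e t = of_real r * exp (2 * of_real pi * \<i> * of_real t)" for t :: real
  have e: "continuous_on A e" "e t \<noteq> 0" for A t
    unfolding e_def using rR by (auto intro!: continuous_intros)
  have uR: "holomorphic_fun_on u (ball z (3 * R))"
    using u rR(4) by (rule holomorphic_fun_on_subset)
  have in2: "x + e t *s v \<in> ball z (2 * R)" if "x \<in> ball z R" for x t
    unfolding e_def by (rule circle_in_ball) (use that rR in auto)
  have in3: "x + e t *s v \<in> ball z (3 * R)" if "x \<in> ball z R" for x t
    using in2[OF that, of t] rR by auto
  have cu: "continuous_on (ball z (2 * R)) u"
    using holomorphic_fun_on_imp_continuous_on[OF uR] rR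
    by (elim continuous_on_subset) auto
  have bl: "bounded_linear (\<lambda>h. frechet_derivative u (at (x + e t *s v)) h / e t)" if "x \<in> ball z R" for x t
    using holomorphic_fun_on_frechet(1)[OF uR in3[OF that]]
    by (intro bounded_linear_compose[OF bounded_linear_divide]) (rule has_derivative_bounded_linear)
  \<comment> \<open>The Leibniz rule wants the derivative of the integrand as a jointly continuous
    family of bounded operators; continuity is checked on one vector at a time.\<close>
  define fx where "fx x t = Blinfun (\<lambda>h. frechet_derivative u (at (x + e t *s v)) h / e t)" for x t
  have fx: "blinfun_apply (fx x t) h = frechet_derivative u (at (x + e t *s v)) h / e t"
    if "x \<in> ball z R" for x t h
    by (simp add: fx_def bounded_linear_Blinfun_apply[OF bl[OF that]])
  have cfx: "continuous_on (ball z R \<times> cbox 0 1) (\<lambda>(x, t). fx x t)"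
  proof (rule continuous_on_blinfun_componentwise)
    fix i :: "complex ^ 'n"
    have "continuous_on (ball z R \<times> cbox 0 1) (\<lambda>p. frechet_derivative u (at (fst p + e (snd p) *s v)) i / e (snd p))"
      using e(2) in3
      by (intro continuous_intros continuous_on_compose2[OF e(1)]
          continuous_on_compose2[OF continuous_on_frechet_holomorphic_fun[OF uR open_ball]]) auto
    then show "continuous_on (ball z R \<times> cbox 0 1) (\<lambda>x. blinfun_apply (case x of (x, t) \<Rightarrow> fx x t) i)"
      by (rule continuous_on_eq) (auto simp: fx)
  qed
  have cont1: "continuous_on (cbox 0 1) (fx z)"
  proof -
    have "continuous_on (cbox 0 1) (\<lambda>t. (z, t :: real))" by (intro continuous_intros)
    moreover have "(\<lambda>t. (z, t)) ` cbox 0 1 \<subseteq> ball z R \<times> cbox (0::real) 1" using rR by auto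
    ultimately show ?thesis
      using continuous_on_compose2[OF cfx] by fastforce
  qed
  have int: "fx z integrable_on cbox 0 1"
    by (rule integrable_continuous[OF cont1])
  have der: "((\<lambda>x. integral (cbox 0 1) (\<lambda>t. u (x + e t *s v) / e t)) has_derivative
      blinfun_apply (integral (cbox 0 1) (fx z))) (at z within ball z R)"
  proof (rule leibniz_rule)
    fix x t assume x: "x \<in> ball z R"
    show "((\<lambda>x. u (x + e t *s v) / e t) has_derivative blinfun_apply (fx x t)) (at x within ball z R)"
    proof -
      have "((\<lambda>x. u (x + e t *s v)) has_derivative frechet_derivative u (at (x + e t *s v))) (at x)"
        by (rule has_derivative_compose[where f = "\<lambda>x. x + e t *s v" and f' = "\<lambda>h. h",
              OF _ holomorphic_fun_on_frechet(1)[OF uR in3[OF x]]])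
           (auto intro!: derivative_eq_intros)
      from bounded_linear.has_derivative[OF bounded_linear_divide this, of "e t"]
      have "((\<lambda>x. u (x + e t *s v) / e t) has_derivative blinfun_apply (fx x t)) (at x)"
        by (simp add: fx[OF x, abs_def])
      then show ?thesis by (rule has_derivative_at_withinI)
    qed
  next
    fix x assume x: "x \<in> ball z R"
    show "(\<lambda>t. u (x + e t *s v) / e t) integrable_on cbox 0 1"
      using e(2) in2[OF x]
      by (intro integrable_continuous continuous_intros continuous_on_compose2[OF cu] e(1)) auto
  qed (use cfx rR in auto)
  have der': "((\<lambda>x. frechet_derivative u (at x) v) has_derivative
      blinfun_apply (integral (cbox 0 1) (fx z))) (at z)"
  proof (rule has_derivative_transform_within_open)
    show "((\<lambda>x. integral (cbox 0 1) (\<lambda>t. u (x + e t *s v) / e t)) has_derivative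
      blinfun_apply (integral (cbox 0 1) (fx z))) (at z)"
      using der rR(2) by (simp add: at_within_open[of _ "ball z R"])
    show "integral (cbox 0 1) (\<lambda>t. u (x + e t *s v) / e t) = frechet_derivative u (at x) v" if "x \<in> ball z R" for x
      by (simp add: circle_integral_representation[OF uR rR(1,3,2) that] e_def)
  qed (use rR in auto)
  have app: "blinfun_apply (integral (cbox 0 1) (fx z)) h = integral (cbox 0 1) (\<lambda>t. fx z t h)" for h
    using integral_linear[OF int blinfun.bounded_linear_left[of h]] by (simp add: o_def)
  have "blinfun_apply (integral (cbox 0 1) (fx z)) (a *s h) = a * blinfun_apply (integral (cbox 0 1) (fx z)) h" for a h
    unfolding app using rR
    by (simp add: fx holomorphic_fun_on_frechet(2)[OF uR in3] integral_mult_right[symmetric] del: integral_mult_right)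
  with der' show "\<exists>L. ((\<lambda>x. frechet_derivative u (at x) v) has_derivative L) (at z) \<and> (\<forall>a h. L (a *s h) = a * L h)"
    by blast
qed

section \<open>The Schwarz lemma for the inverse of an injective holomorphic map\<close>

text \<open>A kernel vector makes the underlying real derivative on \<open>real ^ 4\<close>
  noninjective, hence of rank below 4, which is the hypothesis of Sard's theorem in real
  coordinates.\<close>

lemma Sard_complex2:
  fixes f :: "complex ^ 2 \<Rightarrow> complex ^ 2"
  assumes der: "\<And>x. x \<in> S \<Longrightarrow> (f has_derivative L x) (at x)"
    and sing: "\<And>x. x \<in> S \<Longrightarrow> \<exists>v. v \<noteq> 0 \<and> L x v = 0"
  shows "negligible (f ` S)"
proof -
  obtain \<phi> :: "complex ^ 2 \<Rightarrow> real ^ 4" and \<psi> where lin: "linear \<phi>" "linear \<psi>"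
    and inv: "\<And>x. \<psi> (\<phi> x) = x" "\<And>y. \<phi> (\<psi> y) = y"
    by (rule isomorphisms_UNIV_UNIV[where 'M = "complex ^ 2" and 'N = "real ^ 4"]) auto
  define f' where "f' = (\<lambda>y. \<phi> (f (\<psi> y)))"
  have "negligible (f' ` (\<phi> ` S))"
  proof (rule baby_Sard)
    fix y assume "y \<in> \<phi> ` S"
    then have y: "\<psi> y \<in> S" by (auto simp: inv)
    have "(f' has_derivative (\<lambda>h. \<phi> (L (\<psi> y) (\<psi> h)))) (at y)"
      unfolding f'_def
      by (rule has_derivative_compose[OF has_derivative_compose[OF linear_imp_has_derivative[OF lin(2)] der[OF y]]
            linear_imp_has_derivative[OF lin(1)]])
    then show "(f' has_derivative (\<lambda>h. \<phi> (L (\<psi> y) (\<psi> h)))) (at y within \<phi> ` S)"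
      by (rule has_derivative_at_withinI)
    have l: "linear (\<lambda>h. \<phi> (L (\<psi> y) (\<psi> h)))"
      using has_derivative_linear[OF \<open>(f' has_derivative _) (at y)\<close>] .
    obtain v where v: "v \<noteq> 0" "L (\<psi> y) v = 0" using sing[OF y] by blast
    have "\<not> inj (\<lambda>h. \<phi> (L (\<psi> y) (\<psi> h)))"
    proof
      assume i: "inj (\<lambda>h. \<phi> (L (\<psi> y) (\<psi> h)))"
      have "\<phi> (L (\<psi> y) (\<psi> (\<phi> v))) = \<phi> (L (\<psi> y) (\<psi> 0))"
        using v has_derivative_linear[OF der[OF y]] by (simp add: inv linear_0 lin)
      then have "\<phi> v = 0" using i by (auto dest: injD)
      then show False using v inv(1)[of v] linear_0[OF lin(2)] by simp
    qed
    then show "rank (matrix (\<lambda>h. \<phi> (L (\<psi> y) (\<psi> h)))) < CARD(4)"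
      unfolding less_rank_noninjective matrix_vector_mul(2)[OF l] .
  qed simp
  then have "negligible (\<psi> ` (f' ` (\<phi> ` S)))"
    by (rule negligible_differentiable_image_negligible[rotated])
       (auto intro!: linear_imp_differentiable_on lin)
  moreover have "\<psi> ` (f' ` (\<phi> ` S)) = f ` S"
    by (auto simp: f'_def inv image_image)
  ultimately show ?thesis by simp
qed

text \<open>The shape of a 2 by 2 determinant; with constants inserted it also covers products, sums
  and differences.\<close>

lemma holomorphic_fun_on_diff_prod:
  assumes "holomorphic_fun_on a S" "holomorphic_fun_on b S" "holomorphic_fun_on c S" "holomorphic_fun_on d S"
  shows "holomorphic_fun_on (\<lambda>x. a x * b x - c x * d x) S"
  unfolding holomorphic_fun_on_def
proof
  fix z assume z: "z \<in> S"
  note der = holomorphic_fun_on_frechet[OF assms(1) z] holomorphic_fun_on_frechet[OF assms(2) z]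
    holomorphic_fun_on_frechet[OF assms(3) z] holomorphic_fun_on_frechet[OF assms(4) z]
  have "((\<lambda>x. a x * b x - c x * d x) has_derivative
     (\<lambda>h. (a z * frechet_derivative b (at z) h + frechet_derivative a (at z) h * b z) -
          (c z * frechet_derivative d (at z) h + frechet_derivative c (at z) h * d z))) (at z)"
    by (intro has_derivative_diff has_derivative_mult der)
  then show "\<exists>L. ((\<lambda>x. a x * b x - c x * d x) has_derivative L) (at z) \<and> (\<forall>c v. L (c *s v) = c * L v)"
    by (intro exI conjI, assumption) (simp add: der algebra_simps)
qed

lemma vec2_decompose: "(v :: complex ^ 2) = v $ 1 *s axis 1 1 + v $ 2 *s axis 2 1"
  by (simp add: vec_eq_iff forall_2 axis_def)

lemma holomorphic_map_on_nth:
  "holomorphic_map_on f S \<Longrightarrow> holomorphic_fun_on (\<lambda>x. f x $ i) S"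
  unfolding holomorphic_map_on_def holomorphic_fun_on_def
proof
  fix z assume "\<forall>z\<in>S. \<exists>L. (f has_derivative L) (at z) \<and> (\<forall>c v. L (c *s v) = c *s L v)" "z \<in> S"
  then obtain L where L: "(f has_derivative L) (at z)" "\<And>c v. L (c *s v) = c *s L v" by blast
  from bounded_linear.has_derivative[OF bounded_linear_vec_nth this(1)]
  show "\<exists>L. ((\<lambda>x. f x $ i) has_derivative L) (at z) \<and> (\<forall>c v. L (c *s v) = c * L v)"
    by (intro exI conjI allI, assumption) (simp add: L(2))
qed

lemma holomorphic_map_on_frechet:
  assumes "holomorphic_map_on f S" "x \<in> S"
  shows "(f has_derivative frechet_derivative f (at x)) (at x)"
    and "frechet_derivative f (at x) (a *s v) = a *s frechet_derivative f (at x) v"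
    and "frechet_derivative f (at x) v $ i = frechet_derivative (\<lambda>x. f x $ i) (at x) v"
proof -
  obtain L where L: "(f has_derivative L) (at x)" "\<And>a v. L (a *s v) = a *s L v"
    using assms unfolding holomorphic_map_on_def by blast
  then have eq: "frechet_derivative f (at x) = L" by (metis frechet_derivative_at)
  then show "(f has_derivative frechet_derivative f (at x)) (at x)"
    and "frechet_derivative f (at x) (a *s v) = a *s frechet_derivative f (at x) v"
    using L by auto
  have "((\<lambda>x. f x $ i) has_derivative (\<lambda>v. L v $ i)) (at x)"
    using bounded_linear.has_derivative[OF bounded_linear_vec_nth L(1)] .
  then have "frechet_derivative (\<lambda>x. f x $ i) (at x) = (\<lambda>v. L v $ i)"
    by (metis frechet_derivative_at)
  then show "frechet_derivative f (at x) v $ i = frechet_derivative (\<lambda>x. f x $ i) (at x) v"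
    by (simp add: eq)
qed

lemma holomorphic_map_on_imp_continuous_on:
  "holomorphic_map_on f S \<Longrightarrow> continuous_on S f"
  unfolding holomorphic_map_on_def
  by (meson continuous_at_imp_continuous_on has_derivative_continuous)

definition jacobian :: "(complex ^ 2 \<Rightarrow> complex ^ 2) \<Rightarrow> complex ^ 2 \<Rightarrow> complex" where
  "jacobian f x =
     frechet_derivative (\<lambda>x. f x $ 1) (at x) (axis 1 1) * frechet_derivative (\<lambda>x. f x $ 2) (at x) (axis 2 1) -
     frechet_derivative (\<lambda>x. f x $ 1) (at x) (axis 2 1) * frechet_derivative (\<lambda>x. f x $ 2) (at x) (axis 1 1)"

lemma holomorphic_jacobian:
  "holomorphic_map_on f S \<Longrightarrow> open S \<Longrightarrow> holomorphic_fun_on (jacobian f) S"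
  unfolding jacobian_def
  by (intro holomorphic_fun_on_diff_prod holomorphic_fun_on_directional_derivative holomorphic_map_on_nth)

lemma complex_linear2_kernel:
  fixes L :: "complex ^ 2 \<Rightarrow> complex ^ 2"
  assumes "linear L" "\<And>a v. L (a *s v) = a *s L v"
  shows "(\<exists>v. v \<noteq> 0 \<and> L v = 0) \<longleftrightarrow>
     L (axis 1 1) $ 1 * L (axis 2 1) $ 2 - L (axis 2 1) $ 1 * L (axis 1 1) $ 2 = 0" (is "_ \<longleftrightarrow> ?a * ?d - ?b * ?c = 0")
proof -
  have Lv: "L v = v $ 1 *s L (axis 1 1) + v $ 2 *s L (axis 2 1)" for v
  proof -
    have "L v = L (v $ 1 *s axis 1 1 + v $ 2 *s axis 2 1)"
      by (rule arg_cong[OF vec2_decompose])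
    also have "\<dots> = v $ 1 *s L (axis 1 1) + v $ 2 *s L (axis 2 1)"
      by (simp only: linear_add[OF assms(1)] assms(2))
    finally show ?thesis .
  qed
  have L0: "L v = 0 \<longleftrightarrow> v $ 1 * ?a + v $ 2 * ?b = 0 \<and> v $ 1 * ?c + v $ 2 * ?d = 0" for v
    unfolding Lv[of v] by (simp add: vec_eq_iff forall_2)
  show ?thesis
  proof
    assume "\<exists>v. v \<noteq> 0 \<and> L v = 0"
    then obtain v where v0: "v \<noteq> 0" "L v = 0" by blast
    note v = v0(1) L0[THEN iffD1, OF v0(2), THEN conjunct1] L0[THEN iffD1, OF v0(2), THEN conjunct2]
    have "v $ 1 * (?a * ?d - ?b * ?c) = 0" "v $ 2 * (?a * ?d - ?b * ?c) = 0"
    proof -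
      have "v $ 1 * (?a * ?d - ?b * ?c) = (v $ 1 * ?a + v $ 2 * ?b) * ?d - (v $ 1 * ?c + v $ 2 * ?d) * ?b"
        by (simp add: algebra_simps)
      then show "v $ 1 * (?a * ?d - ?b * ?c) = 0" using v(2,3) by simp
      have "v $ 2 * (?a * ?d - ?b * ?c) = (v $ 1 * ?c + v $ 2 * ?d) * ?a - (v $ 1 * ?a + v $ 2 * ?b) * ?c"
        by (simp add: algebra_simps)
      then show "v $ 2 * (?a * ?d - ?b * ?c) = 0" using v(2,3) by simp
    qed
    then show "?a * ?d - ?b * ?c = 0" using v(1) by (auto simp: vec_eq_iff forall_2)
  next
    assume z: "?a * ?d - ?b * ?c = 0"
    \<comment> \<open>The vector annihilated by the first row, or by the second one if the first is
      zero. It vanishes only if all four entries do, and then every vector is in the kernel.\<close>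
    define v :: "complex ^ 2" where "v = (if ?a = 0 \<and> ?b = 0 then vector [?d, - ?c] else vector [?b, - ?a])"
    show "\<exists>v. v \<noteq> 0 \<and> L v = 0"
    proof (cases "v = 0")
      case False
      moreover have "L v = 0"
        by (rule L0[THEN iffD2]) (use z in \<open>auto simp: v_def vector_2 algebra_simps\<close>)
      ultimately show ?thesis by blast
    next
      case True
      then have "?a = 0 \<and> ?b = 0 \<and> ?c = 0 \<and> ?d = 0"
        by (auto simp: v_def vec_eq_iff forall_2 vector_2 split: if_splits)
      then have "L (axis 1 1) = 0" by (simp add: vec_eq_iff forall_2)
      moreover have "axis 1 1 \<noteq> (0 :: complex ^ 2)" by (simp add: axis_eq_0_iff)
      ultimately show ?thesis by blast
    qed
  qed
qed

lemma jacobian_eq_0_iff: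
  assumes "holomorphic_map_on f S" "x \<in> S"
  shows "jacobian f x = 0 \<longleftrightarrow> (\<exists>v. v \<noteq> 0 \<and> frechet_derivative f (at x) v = 0)"
  using complex_linear2_kernel[OF has_derivative_linear[OF holomorphic_map_on_frechet(1)[OF assms]]
      holomorphic_map_on_frechet(2)[OF assms]]
  by (simp add: jacobian_def holomorphic_map_on_frechet(3)[OF assms])

section \<open>The gauge of the bidisk and the inverse of an injective holomorphic map\<close>

definition sup_norm2 :: "complex ^ 2 \<Rightarrow> real" where
  "sup_norm2 y = max (cmod (y $ 1)) (cmod (y $ 2))"

lemma polydisk_iff_sup_norm2: "y \<in> polydisk r \<longleftrightarrow> sup_norm2 y < r"
  by (auto simp: polydisk_def sup_norm2_def forall_2)

lemma sup_norm2_nonneg [simp]: "0 \<le> sup_norm2 y"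
  by (simp add: sup_norm2_def le_max_iff_disj)

lemma sup_norm2_smult: "sup_norm2 (c *s y) = cmod c * sup_norm2 y"
  by (simp add: sup_norm2_def norm_mult max_mult_distrib_left)

lemma sup_norm2_triangle: "sup_norm2 (x + y) \<le> sup_norm2 x + sup_norm2 y"
  unfolding sup_norm2_def
  using norm_triangle_ineq[of "x $ 1" "y $ 1"] norm_triangle_ineq[of "x $ 2" "y $ 2"]
  by (simp add: max_def)

lemma sup_norm2_eq_0_iff: "sup_norm2 y = 0 \<longleftrightarrow> y = 0"
  by (auto simp: sup_norm2_def vec_eq_iff forall_2 max_def split: if_splits)

lemma continuous_on_sup_norm2: "continuous_on A sup_norm2"
  unfolding sup_norm2_def by (intro continuous_intros)

lemma tendsto_sup_norm2 [tendsto_intros]: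
  "(f \<longlongrightarrow> y) F \<Longrightarrow> ((\<lambda>x. sup_norm2 (f x)) \<longlongrightarrow> sup_norm2 y) F"
  using continuous_on_tendsto_compose[OF continuous_on_sup_norm2[of UNIV]] by simp

lemma open_polydisk2: "open (polydisk r :: (complex ^ 2) set)"
proof -
  have "polydisk r = {y. sup_norm2 y < r}" by (auto simp: polydisk_iff_sup_norm2)
  then show ?thesis by (simp add: open_Collect_less continuous_on_sup_norm2)
qed

text \<open>Only the inner bidisk is recorded, so that the radius can be decreased at will. The
  inclusion of the image in the unit bidisk enters separately, in the upper bound for the
  derivative.\<close>

locale injective_holomorphic =
  fixes f :: "complex ^ 2 \<Rightarrow> complex ^ 2" and \<Omega> :: "(complex ^ 2) set" and s :: real
  assumes open_\<Omega>: "open \<Omega>" and hol: "holomorphic_map_on f \<Omega>" and inj: "inj_on f \<Omega>"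
    and s_pos: "0 < s" and image: "polydisk s \<subseteq> f ` \<Omega>"
begin

abbreviation "g \<equiv> inv_into \<Omega> f"

lemma g_in: "y \<in> polydisk s \<Longrightarrow> g y \<in> \<Omega>" and f_g: "y \<in> polydisk s \<Longrightarrow> f (g y) = y"
  using image by (auto simp: inv_into_into f_inv_into_f subset_iff)

lemma g_f: "x \<in> \<Omega> \<Longrightarrow> g (f x) = x"
  using inj by simp

text \<open>Invariance of domain gives this before anything is known about zeros of the
  Jacobian.\<close>

lemma continuous_on_g: "continuous_on (polydisk s) g"
proof -
  have "continuous_on (f ` \<Omega>) g"
    by (rule continuous_on_inverse_open)
       (use open_\<Omega> holomorphic_map_on_imp_continuous_on[OF hol] g_f in auto)
  then show ?thesis using image by (rule continuous_on_subset)
qed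

text \<open>Once \<open>g\<close> is continuous, an invertible derivative of \<open>f\<close>
  suffices, and the inverse of a complex linear bijection is complex linear.\<close>

lemma g_has_derivative:
  assumes y: "y \<in> polydisk s" and J: "jacobian f (g y) \<noteq> 0"
  obtains L where "(g has_derivative L) (at y)" "\<And>a v. L (a *s v) = a *s L v"
proof -
  define D where "D = frechet_derivative f (at (g y))"
  note D = holomorphic_map_on_frechet[OF hol g_in[OF y], folded D_def]
  have lD: "linear D" using D(1) by (rule has_derivative_linear)
  have "\<not> (\<exists>v. v \<noteq> 0 \<and> D v = 0)"
    using J jacobian_eq_0_iff[OF hol g_in[OF y]] by (simp add: D_def)
  then have injD: "inj D"
    using linear_injective_0[OF lD] by metis
  then obtain L where L: "linear L" "\<And>x. L (D x) = x" "\<And>x. D (L x) = x"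
    using linear_injective_isomorphism[OF lD] by blast
  have "(g has_derivative L) (at y)"
  proof (rule has_derivative_inverse_basic)
    show "(f has_derivative D) (at (g y))" by (rule D(1))
    show "bounded_linear L" using L(1) by (simp add: linear_conv_bounded_linear)
    show "L \<circ> D = id" using L(2) by auto
    show "continuous (at y) g"
      using continuous_on_g open_polydisk2 y by (simp add: continuous_on_eq_continuous_at)
  qed (use open_polydisk2 y f_g in auto)
  moreover have "L (a *s v) = a *s L v" for a v
    using injD by (metis D(2) L(2,3))
  ultimately show ?thesis by (rule that)
qed

text \<open>An open set of critical values would be the image of critical points, hence negligible
  by Sard's theorem.\<close>

lemma regular_values_dense:
  assumes "y \<in> polydisk s"
  shows "y \<in> closure {y \<in> polydisk s. jacobian f (g y) \<noteq> 0}"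
proof (rule ccontr)
  assume "y \<notin> closure {y \<in> polydisk s. jacobian f (g y) \<noteq> 0}"
  then obtain U where U: "open U" "y \<in> U" "U \<inter> {y \<in> polydisk s. jacobian f (g y) \<noteq> 0} = {}"
    unfolding closure_iff_nhds_not_empty by blast
  define V where "V = U \<inter> polydisk s"
  have V: "open V" "y \<in> V" using U assms open_polydisk2 by (auto simp: V_def)
  have "negligible (f ` (g ` V))"
  proof (rule Sard_complex2)
    fix x assume "x \<in> g ` V"
    then have x: "x \<in> \<Omega>" "jacobian f x = 0"
      using U by (auto simp: V_def g_in)
    show "(f has_derivative frechet_derivative f (at x)) (at x)"
      by (rule holomorphic_map_on_frechet(1)[OF hol x(1)])
    show "\<exists>v. v \<noteq> 0 \<and> frechet_derivative f (at x) v = 0"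
      using x jacobian_eq_0_iff[OF hol] by blast
  qed
  moreover have "f ` (g ` V) = V"
    by (force simp: V_def f_g image_iff)
  ultimately show False using open_not_negligible[of V] V by auto
qed

text \<open>The centre of the disk has to be a regular value, and 0 is not known to be one.
  Therefore the centre is a variable \<open>y0\<close>; subtracting \<open>h (g y0)\<close> restores
  the zero at the centre and adds its modulus to the bound.\<close>

lemma Schwarz_between_regular_values:
  assumes h: "holomorphic_fun_on h {x \<in> \<Omega>. f x \<in> polydisk s}"
    and M: "\<And>x. x \<in> \<Omega> \<Longrightarrow> f x \<in> polydisk s \<Longrightarrow> cmod (h x) \<le> M"
    and y: "y0 \<in> polydisk s" "jacobian f (g y0) \<noteq> 0" "y1 \<in> polydisk s" "jacobian f (g y1) \<noteq> 0"
    and s0: "sup_norm2 y0 + s0 < s" "sup_norm2 (y1 - y0) < s0"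
  shows "cmod (h (g y1) - h (g y0)) * s0 \<le> (M + cmod (h (g y0))) * sup_norm2 (y1 - y0)"
proof (cases "y1 = y0")
  case True
  then have "sup_norm2 (y1 - y0) = 0" by (simp add: sup_norm2_eq_0_iff)
  then show ?thesis using True by simp
next
  case False
  define \<sigma> where "\<sigma> = sup_norm2 (y1 - y0)"
  have \<sigma>: "0 < \<sigma>" "\<sigma> < s0"
    using False s0 sup_norm2_eq_0_iff[of "y1 - y0"] sup_norm2_nonneg[of "y1 - y0"]
    by (auto simp: \<sigma>_def less_le)
  \<comment> \<open>The direction is scaled to sup norm \<open>s0\<close>: the closed unit disk then
    stays in \<open>polydisk s\<close>, and \<open>y1\<close> has a parameter of modulus
    \<open>\<sigma> / s0\<close>.\<close>
  define e where "e = of_real (s0 / \<sigma>) *s (y1 - y0)"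
  have e: "sup_norm2 e = s0"
    unfolding e_def sup_norm2_smult using \<sigma> by (simp add: \<sigma>_def[symmetric] norm_divide)
  define l1 :: complex where "l1 = of_real (\<sigma> / s0)"
  have l1: "y0 + l1 *s e = y1" "cmod l1 = \<sigma> / s0"
    using \<sigma> by (auto simp: e_def l1_def vec_eq_iff norm_divide)
  have inP: "y0 + l *s e \<in> polydisk s" if "cmod l \<le> 1" for l
  proof -
    have "sup_norm2 (y0 + l *s e) \<le> sup_norm2 y0 + cmod l * s0"
      using sup_norm2_triangle[of y0 "l *s e"] by (simp add: sup_norm2_smult e)
    also have "\<dots> \<le> sup_norm2 y0 + s0" using that \<sigma> by (simp add: mult_left_le_one_le)
    finally show ?thesis using s0 by (simp add: polydisk_iff_sup_norm2)
  qed
  define c where "c l = g (y0 + l *s e)" for l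
  have c_in: "c l \<in> {x \<in> \<Omega>. f x \<in> polydisk s}" if "cmod l \<le> 1" for l
    using inP[OF that] by (simp add: c_def g_in f_g)
  have contc: "continuous_on (cball 0 1) c"
    unfolding c_def using inP
    by (intro continuous_on_compose2[OF continuous_on_g] continuous_intros) auto
  have holc: "(\<lambda>l. u (c l)) holomorphic_on {l \<in> ball 0 1. jacobian f (c l) \<noteq> 0}"
    if u: "holomorphic_fun_on u {x \<in> \<Omega>. f x \<in> polydisk s}" for u
    unfolding holomorphic_on_def
  proof (rule ballI, rule field_differentiable_at_within)
    fix l assume "l \<in> {l \<in> ball 0 1. jacobian f (c l) \<noteq> 0}"
    then have l: "cmod l \<le> 1" "jacobian f (g (y0 + l *s e)) \<noteq> 0" by (auto simp: c_def)
    obtain L where L: "(g has_derivative L) (at (y0 + l *s e))" "\<And>a v. L (a *s v) = a *s L v"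
      using g_has_derivative[OF inP[OF l(1)] l(2)] by blast
    have "(c has_derivative (\<lambda>h. h *s L e)) (at l)"
      unfolding c_def using has_derivative_compose[OF has_derivative_affine_line L(1)] by (simp add: L(2))
    moreover note holomorphic_fun_on_frechet[OF u c_in[OF l(1)]]
    ultimately show "(\<lambda>l. u (c l)) field_differentiable at l"
      using has_field_derivative_along_curve unfolding field_differentiable_def by blast
  qed
  have J: "holomorphic_fun_on (jacobian f) {x \<in> \<Omega>. f x \<in> polydisk s}"
    by (rule holomorphic_fun_on_subset[OF holomorphic_jacobian[OF hol open_\<Omega>]]) auto
  have contu: "continuous_on (cball 0 1) (\<lambda>l. u (c l))"
    if u: "holomorphic_fun_on u {x \<in> \<Omega>. f x \<in> polydisk s}" for u
    using c_in
    by (intro continuous_on_compose2[OF holomorphic_fun_on_imp_continuous_on[OF u] contc]) auto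
  have "cmod (h (c l1) - h (c 0)) \<le> (M + cmod (h (c 0))) * cmod l1"
  proof (rule Schwarz_off_zeros[where F = "\<lambda>l. jacobian f (c l)" and k = "\<lambda>l. h (c l) - h (c 0)"])
    show "cmod (h (c l) - h (c 0)) \<le> M + cmod (h (c 0))" if "cmod l = 1" for l
      using M[of "c l"] c_in[of l] that norm_triangle_ineq4[of "h (c l)" "h (c 0)"] by auto
    show "jacobian f (c 0) \<noteq> 0" "jacobian f (c l1) \<noteq> 0"
      using y l1 by (simp_all add: c_def)
    show "cmod l1 < 1" using l1 \<sigma> by simp
  qed (use holc[OF J] holc[OF h] contu[OF J] contu[OF h] in \<open>auto intro!: holomorphic_intros continuous_intros\<close>)
  then show ?thesis
    using \<sigma> l1 by (simp add: c_def field_simps \<sigma>_def)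
qed

text \<open>Holomorphy of the inverse map is not available; instead the estimate is obtained on the dense
  set of regular values and extended by continuity.\<close>

lemma Schwarz_inverse:
  assumes h: "holomorphic_fun_on h {x \<in> \<Omega>. f x \<in> polydisk s}"
    and M: "\<And>x. x \<in> \<Omega> \<Longrightarrow> f x \<in> polydisk s \<Longrightarrow> cmod (h x) \<le> M"
    and z: "z \<in> \<Omega>" "f z = 0" "h z = 0"
    and x: "x \<in> \<Omega>" "f x \<in> polydisk s"
  shows "cmod (h x) \<le> M / s * sup_norm2 (f x)"
proof -
  let ?R = "{y \<in> polydisk s. jacobian f (g y) \<noteq> 0}"
  have zero: "0 \<in> polydisk s" using s_pos by (simp add: polydisk_def)
  have gz: "g 0 = z" using g_f z by metis
  have gx: "g (f x) = x" using g_f x by metis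
  have contk: "continuous_on (polydisk s) (\<lambda>y. h (g y))"
    using g_in f_g
    by (intro continuous_on_compose2[OF holomorphic_fun_on_imp_continuous_on[OF h] continuous_on_g]) auto
  obtain a where a: "\<And>n. a n \<in> ?R" "a \<longlonglongrightarrow> 0"
    using regular_values_dense[OF zero] unfolding closure_sequential by blast
  obtain b where b: "\<And>n. b n \<in> ?R" "b \<longlonglongrightarrow> f x"
    using regular_values_dense[OF x(2)] unfolding closure_sequential by blast
  have ka: "(\<lambda>n. h (g (a n))) \<longlonglongrightarrow> 0"
    using continuous_on_tendsto_compose[OF contk a(2) zero] a(1) by (simp add: gz z)
  have kb: "(\<lambda>n. h (g (b n))) \<longlonglongrightarrow> h x"
    using continuous_on_tendsto_compose[OF contk b(2) x(2)] b(1) by (simp add: gx)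
  \<comment> \<open>A radius strictly below \<open>s\<close> lets the disks centred at the nearby
    points \<open>a n\<close> fit; it tends to \<open>s\<close> at the end.\<close>
  have main: "cmod (h x) * s0 \<le> M * sup_norm2 (f x)" if s0: "sup_norm2 (f x) < s0" "s0 < s" for s0
  proof (rule tendsto_le[OF sequentially_bot])
    show "(\<lambda>n. cmod (h (g (b n)) - h (g (a n))) * s0) \<longlonglongrightarrow> cmod (h x) * s0"
      using tendsto_mult[OF tendsto_norm[OF tendsto_diff[OF kb ka]] tendsto_const, of s0] by simp
    have ba: "(\<lambda>n. sup_norm2 (b n - a n)) \<longlonglongrightarrow> sup_norm2 (f x)"
      using tendsto_sup_norm2[OF tendsto_diff[OF b(2) a(2)]] by simp
    then show "(\<lambda>n. (M + cmod (h (g (a n)))) * sup_norm2 (b n - a n)) \<longlonglongrightarrow> M * sup_norm2 (f x)"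
      using tendsto_mult[OF tendsto_add[OF tendsto_const tendsto_norm[OF ka], of M] ba] by simp
    have "(\<lambda>n. sup_norm2 (a n)) \<longlonglongrightarrow> 0"
      using tendsto_sup_norm2[OF a(2)] by (simp add: sup_norm2_eq_0_iff[of 0, simplified])
    then have "\<forall>\<^sub>F n in sequentially. sup_norm2 (a n) < s - s0"
      using s0 by (intro order_tendstoD(2)) auto
    moreover have "\<forall>\<^sub>F n in sequentially. sup_norm2 (b n - a n) < s0"
      using ba s0 by (intro order_tendstoD(2)) auto
    ultimately show "\<forall>\<^sub>F n in sequentially. cmod (h (g (b n)) - h (g (a n))) * s0
        \<le> (M + cmod (h (g (a n)))) * sup_norm2 (b n - a n)"
    proof eventually_elim
      case (elim n)
      show ?case
        by (rule Schwarz_between_regular_values[OF h M]) (use elim a(1)[of n] b(1)[of n] in auto)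
    qed
  qed
  have "cmod (h x) * s \<le> M * sup_norm2 (f x)"
  proof (rule tendsto_upperbound)
    show "((\<lambda>t. cmod (h x) * t) \<longlongrightarrow> cmod (h x) * s) (at_left s)"
      by (intro tendsto_intros)
    have "sup_norm2 (f x) < s" using x(2) by (simp add: polydisk_iff_sup_norm2)
    then show "\<forall>\<^sub>F t in at_left s. cmod (h x) * t \<le> M * sup_norm2 (f x)"
      unfolding eventually_at_left_field using main by blast
  qed simp
  then show ?thesis using s_pos by (simp add: field_simps)
qed

end

section \<open>Second-order expansion at a point\<close>

text \<open>First derivatives exist on \<open>V\<close>, second derivatives at \<open>q\<close>
  alone. \<open>B u v\<close> differentiates \<open>D x v\<close> in direction \<open>u\<close>; its
  linearity in \<open>v\<close> and its symmetry are proved below.\<close>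

locale twice_differentiable =
  fixes \<rho> :: "'a::euclidean_space \<Rightarrow> real" and q :: 'a and V and D B :: "'a \<Rightarrow> 'a \<Rightarrow> real"
  assumes open_V: "open V" and q_in: "q \<in> V"
    and D: "\<And>x. x \<in> V \<Longrightarrow> (\<rho> has_derivative D x) (at x)"
    and B: "\<And>v. ((\<lambda>x. D x v) has_derivative (\<lambda>u. B u v)) (at q)"
begin

lemma linear_D: "x \<in> V \<Longrightarrow> linear (D x)"
  using D by (rule has_derivative_linear)

lemma linear_B_left: "linear (\<lambda>u. B u v)"
  using B by (rule has_derivative_linear)

lemma linear_B_right: "linear (B u)"
proof (rule linearI)
  fix v w :: 'a and c :: real
  have "((\<lambda>x. D x (v + w)) has_derivative (\<lambda>u. B u v + B u w)) (at q)"
    by (rule has_derivative_transform_within_open[OF has_derivative_add[OF B B] open_V q_in])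
       (simp add: linear_add[OF linear_D])
  from has_derivative_unique[OF this B] show "B u (v + w) = B u v + B u w" by metis
  have "((\<lambda>x. D x (c *\<^sub>R v)) has_derivative (\<lambda>u. c *\<^sub>R B u v)) (at q)"
    by (rule has_derivative_transform_within_open[OF has_derivative_scaleR_right[OF B] open_V q_in])
       (simp add: linear_cmul[OF linear_D])
  from has_derivative_unique[OF this B] show "B u (c *\<^sub>R v) = c *\<^sub>R B u v" by metis
qed

lemma bilinear_B: "bilinear B"
  by (simp add: bilinear_def linear_B_left linear_B_right)

text \<open>Differentiability gives a radius for each \<open>v\<close> separately. Finitely many
  basis vectors make it uniform, and dividing \<open>\<eta>\<close> by the dimension pays for the
  sum.\<close>

lemma gradient_expansion:
  assumes \<eta>: "0 < \<eta>"
  obtains d where "0 < d" "\<And>x. norm x < d \<Longrightarrow> q + x \<in> V"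
    "\<And>x v. norm x < d \<Longrightarrow> \<bar>D (q + x) v - D q v - B x v\<bar> \<le> \<eta> * norm x * norm v"
proof -
  define \<eta>' where "\<eta>' = \<eta> / real (DIM('a))"
  have \<eta>': "0 < \<eta>'" using \<eta> by (simp add: \<eta>'_def)
  have ev: "\<forall>\<^sub>F x in nhds 0. \<bar>D (q + x) i - D q i - B x i\<bar> \<le> \<eta>' * norm x" for i
  proof -
    obtain d where d: "0 < d" "\<And>y. norm (y - q) < d \<Longrightarrow> norm (D y i - D q i - B (y - q) i) \<le> \<eta>' * norm (y - q)"
      using B[of i] \<eta>' unfolding has_derivative_at_alt by blast
    have "\<bar>D (q + x) i - D q i - B x i\<bar> \<le> \<eta>' * norm x" if "dist x 0 < d" for x
      using d(2)[of "q + x"] that by simp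
    then show ?thesis using d(1) unfolding eventually_nhds_metric by blast
  qed
  have "\<forall>\<^sub>F x in nhds 0. \<forall>i\<in>Basis. \<bar>D (q + x) i - D q i - B x i\<bar> \<le> \<eta>' * norm x"
    by (intro eventually_ball_finite ballI ev) simp
  then obtain d1 where d1: "0 < d1"
    "\<And>x i. norm x < d1 \<Longrightarrow> i \<in> Basis \<Longrightarrow> \<bar>D (q + x) i - D q i - B x i\<bar> \<le> \<eta>' * norm x"
    unfolding eventually_nhds_metric by (auto simp: dist_norm)
  obtain d2 where d2: "0 < d2" "ball q d2 \<subseteq> V"
    using open_V q_in open_contains_ball by blast
  show ?thesis
  proof
    show "0 < min d1 d2" using d1 d2 by simp
    fix x :: 'a assume x: "norm x < min d1 d2"
    then show V: "q + x \<in> V" using d2(2) by (auto simp: subset_iff dist_norm)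
    fix v :: 'a
    define E where "E v = D (q + x) v - D q v - B x v" for v
    have lE: "linear E"
      unfolding E_def[abs_def]
      by (intro linear_compose_sub linear_D V q_in linear_B_right)
    have "E v = E (\<Sum>i\<in>Basis. (v \<bullet> i) *\<^sub>R i)" by (simp add: euclidean_representation)
    also have "\<dots> = (\<Sum>i\<in>Basis. (v \<bullet> i) * E i)"
      by (simp add: linear_sum[OF lE] linear_cmul[OF lE])
    finally have "\<bar>E v\<bar> \<le> (\<Sum>i\<in>Basis. \<bar>(v \<bullet> i) * E i\<bar>)" by (simp add: sum_abs)
    also have "\<dots> \<le> (\<Sum>i\<in>(Basis::'a set). norm v * (\<eta>' * norm x))"
      unfolding abs_mult using d1(2) x Basis_le_norm
      by (intro sum_mono mult_mono) (auto simp: E_def)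
    also have "\<dots> = \<eta> * norm x * norm v" by (simp add: \<eta>'_def)
    finally show "\<bar>D (q + x) v - D q v - B x v\<bar> \<le> \<eta> * norm x * norm v" by (simp add: E_def)
  qed
qed

lemma Taylor_second_order:
  assumes \<eta>: "0 < \<eta>"
  obtains d where "0 < d" "\<And>x. norm x < d \<Longrightarrow> q + x \<in> V"
    "\<And>x. norm x < d \<Longrightarrow> \<bar>\<rho> (q + x) - \<rho> q - D q x - B x x / 2\<bar> \<le> \<eta> * (norm x)\<^sup>2"
proof -
  obtain d where d: "0 < d" "\<And>x. norm x < d \<Longrightarrow> q + x \<in> V"
    "\<And>x v. norm x < d \<Longrightarrow> \<bar>D (q + x) v - D q v - B x v\<bar> \<le> \<eta> * norm x * norm v"
    using gradient_expansion[OF \<eta>] by blast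
  show ?thesis
  proof
    fix x :: 'a assume x: "norm x < d"
    \<comment> \<open>The derivative of this remainder along the segment is the quantity estimated
      by \<open>gradient_expansion\<close>, so the mean value theorem applies.\<close>
    define \<psi> where "\<psi> s = \<rho> (q + s *\<^sub>R x) - s * D q x - s\<^sup>2 * (B x x / 2)" for s :: real
    have sx: "norm (s *\<^sub>R x) < d" if "0 \<le> s" "s \<le> 1" for s
      using x that mult_right_mono[OF that(2) norm_ge_zero[of x]] by simp
    have der: "(\<psi> has_real_derivative D (q + s *\<^sub>R x) x - D q x - B (s *\<^sub>R x) x) (at s)"
      if "0 \<le> s" "s \<le> 1" for s
    proof -
      have V: "q + s *\<^sub>R x \<in> V" using d(2)[OF sx[OF that]] .
      have "((\<lambda>s. \<rho> (q + s *\<^sub>R x)) has_derivative (\<lambda>h. D (q + s *\<^sub>R x) (h *\<^sub>R x))) (at s)"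
        by (rule has_derivative_compose[where f = "\<lambda>s. q + s *\<^sub>R x", OF _ D[OF V]])
           (auto intro!: derivative_eq_intros)
      then have 1: "((\<lambda>s. \<rho> (q + s *\<^sub>R x)) has_real_derivative D (q + s *\<^sub>R x) x) (at s)"
        by (simp add: has_field_derivative_def linear_cmul[OF linear_D[OF V]] mult_commute_abs)
      show ?thesis
        unfolding \<psi>_def
        by (auto intro!: derivative_eq_intros 1 simp: linear_cmul[OF linear_B_left])
    qed
    obtain s where s: "0 < s" "s < 1"
      "\<psi> 1 - \<psi> 0 = (1 - 0) * (D (q + s *\<^sub>R x) x - D q x - B (s *\<^sub>R x) x)"
      using MVT2[of 0 1 \<psi> "\<lambda>s. D (q + s *\<^sub>R x) x - D q x - B (s *\<^sub>R x) x"] der by auto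
    have "\<bar>\<psi> 1 - \<psi> 0\<bar> \<le> \<eta> * norm (s *\<^sub>R x) * norm x"
      unfolding s(3) using d(3)[OF sx, of s x] s by simp
    also have "\<dots> \<le> \<eta> * (norm x * norm x)"
    proof -
      have "s * (norm x * norm x) \<le> 1 * (norm x * norm x)" using s by (intro mult_right_mono) auto
      then show ?thesis using s \<eta> by (simp add: mult.assoc)
    qed
    finally show "\<bar>\<rho> (q + x) - \<rho> q - D q x - B x x / 2\<bar> \<le> \<eta> * (norm x)\<^sup>2"
      by (simp add: \<psi>_def power2_eq_square algebra_simps)
  qed (use d in auto)
qed

text \<open>The mixed difference is symmetric in \<open>u\<close> and \<open>v\<close>, while its
  leading coefficient is \<open>B v u\<close>; this yields the symmetry of \<open>B\<close>. The
  mean value theorem is applied in direction \<open>u\<close> to the increment in direction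
  \<open>v\<close>.\<close>

lemma second_difference:
  assumes \<eta>: "0 < \<eta>"
  obtains e where "0 < e"
    "\<And>s. 0 < s \<Longrightarrow> s < e \<Longrightarrow> \<bar>\<rho> (q + s *\<^sub>R u + s *\<^sub>R v) - \<rho> (q + s *\<^sub>R u) - \<rho> (q + s *\<^sub>R v) + \<rho> q - s\<^sup>2 * B v u\<bar>
       \<le> s\<^sup>2 * (2 * \<eta> * (norm u + norm v) * norm u)"
proof -
  obtain d where d: "0 < d" "\<And>x. norm x < d \<Longrightarrow> q + x \<in> V"
    "\<And>x v. norm x < d \<Longrightarrow> \<bar>D (q + x) v - D q v - B x v\<bar> \<le> \<eta> * norm x * norm v"
    using gradient_expansion[OF \<eta>] by blast
  define N where "N = norm u + norm v"
  have N: "0 \<le> N" by (simp add: N_def)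
  show ?thesis
  proof
    show "0 < d / (N + 1)" using d N by simp
    fix s assume s: "0 < s" "s < d / (N + 1)"
    have sN: "s * N < d"
    proof -
      have "s * N \<le> s * (N + 1)" using s by simp
      also have "\<dots> < d" using s N by (simp add: field_simps)
      finally show ?thesis .
    qed
    have n1: "norm (\<tau> *\<^sub>R u + s *\<^sub>R v) \<le> s * N" and n2: "norm (\<tau> *\<^sub>R u) \<le> s * N"
      if "0 \<le> \<tau>" "\<tau> \<le> s" for \<tau>
    proof -
      have "norm (\<tau> *\<^sub>R u + s *\<^sub>R v) \<le> \<tau> * norm u + s * norm v"
        using norm_triangle_ineq[of "\<tau> *\<^sub>R u" "s *\<^sub>R v"] that s by simp
      moreover have "\<tau> * norm u \<le> s * norm u" using that by (simp add: mult_right_mono)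
      moreover have "0 \<le> s * norm v" using s by simp
      moreover have "s * N = s * norm u + s * norm v" by (simp add: N_def distrib_left)
      moreover have "norm (\<tau> *\<^sub>R u) = \<tau> * norm u" using that by simp
      ultimately show "norm (\<tau> *\<^sub>R u + s *\<^sub>R v) \<le> s * N" "norm (\<tau> *\<^sub>R u) \<le> s * N"
        by linarith+
    qed
    define \<phi> where "\<phi> \<tau> = \<rho> (q + (\<tau> *\<^sub>R u + s *\<^sub>R v)) - \<rho> (q + \<tau> *\<^sub>R u)" for \<tau>
    have der: "(\<phi> has_real_derivative D (q + (\<tau> *\<^sub>R u + s *\<^sub>R v)) u - D (q + \<tau> *\<^sub>R u) u) (at \<tau>)"
      if "0 \<le> \<tau>" "\<tau> \<le> s" for \<tau>
    proof -
      have V: "q + (\<tau> *\<^sub>R u + s *\<^sub>R v) \<in> V" "q + \<tau> *\<^sub>R u \<in> V"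
        using d(2) n1[OF that] n2[OF that] sN by (meson le_less_trans)+
      have "((\<lambda>\<tau>. \<rho> (q + (\<tau> *\<^sub>R u + s *\<^sub>R v))) has_derivative (\<lambda>h. D (q + (\<tau> *\<^sub>R u + s *\<^sub>R v)) (h *\<^sub>R u))) (at \<tau>)"
        by (rule has_derivative_compose[where f = "\<lambda>\<tau>. q + (\<tau> *\<^sub>R u + s *\<^sub>R v)", OF _ D[OF V(1)]])
           (auto intro!: derivative_eq_intros)
      moreover have "((\<lambda>\<tau>. \<rho> (q + \<tau> *\<^sub>R u)) has_derivative (\<lambda>h. D (q + \<tau> *\<^sub>R u) (h *\<^sub>R u))) (at \<tau>)"
        by (rule has_derivative_compose[where f = "\<lambda>\<tau>. q + \<tau> *\<^sub>R u", OF _ D[OF V(2)]])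
           (auto intro!: derivative_eq_intros)
      ultimately have "(\<phi> has_derivative (\<lambda>h. D (q + (\<tau> *\<^sub>R u + s *\<^sub>R v)) (h *\<^sub>R u) - D (q + \<tau> *\<^sub>R u) (h *\<^sub>R u))) (at \<tau>)"
        unfolding \<phi>_def by (rule has_derivative_diff)
      then show ?thesis
        by (simp add: has_field_derivative_def linear_cmul[OF linear_D[OF V(1)]]
            linear_cmul[OF linear_D[OF V(2)]] right_diff_distrib[symmetric] mult_commute_abs)
    qed
    obtain \<tau> where \<tau>: "0 < \<tau>" "\<tau> < s"
      "\<phi> s - \<phi> 0 = (s - 0) * (D (q + (\<tau> *\<^sub>R u + s *\<^sub>R v)) u - D (q + \<tau> *\<^sub>R u) u)"
      using MVT2[of 0 s \<phi> "\<lambda>\<tau>. D (q + (\<tau> *\<^sub>R u + s *\<^sub>R v)) u - D (q + \<tau> *\<^sub>R u) u"] der s by auto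
    note n = n1[of \<tau>] n2[of \<tau>]
    have e1: "\<bar>D (q + (\<tau> *\<^sub>R u + s *\<^sub>R v)) u - D q u - B (\<tau> *\<^sub>R u + s *\<^sub>R v) u\<bar> \<le> \<eta> * (s * N) * norm u"
    proof -
      have "\<bar>D (q + (\<tau> *\<^sub>R u + s *\<^sub>R v)) u - D q u - B (\<tau> *\<^sub>R u + s *\<^sub>R v) u\<bar> \<le> \<eta> * norm (\<tau> *\<^sub>R u + s *\<^sub>R v) * norm u"
        using n \<tau> sN by (intro d(3)) auto
      also have "\<dots> \<le> \<eta> * (s * N) * norm u"
        using n \<tau> \<eta> by (intro mult_right_mono mult_left_mono) auto
      finally show ?thesis .
    qed
    have e2: "\<bar>D (q + \<tau> *\<^sub>R u) u - D q u - B (\<tau> *\<^sub>R u) u\<bar> \<le> \<eta> * (s * N) * norm u"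
    proof -
      have "\<bar>D (q + \<tau> *\<^sub>R u) u - D q u - B (\<tau> *\<^sub>R u) u\<bar> \<le> \<eta> * norm (\<tau> *\<^sub>R u) * norm u"
        using n \<tau> sN by (intro d(3)) auto
      also have "\<dots> \<le> \<eta> * (s * N) * norm u"
        using n \<tau> \<eta> by (intro mult_right_mono mult_left_mono) auto
      finally show ?thesis .
    qed
    have Badd: "B (\<tau> *\<^sub>R u + s *\<^sub>R v) u = B (\<tau> *\<^sub>R u) u + s * B v u"
      by (simp add: linear_add[OF linear_B_left] linear_cmul[OF linear_B_left])
    have "\<bar>(D (q + (\<tau> *\<^sub>R u + s *\<^sub>R v)) u - D (q + \<tau> *\<^sub>R u) u) - s * B v u\<bar> \<le> 2 * (\<eta> * (s * N) * norm u)"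
      using e1 e2 unfolding Badd by linarith
    then have "s * \<bar>(D (q + (\<tau> *\<^sub>R u + s *\<^sub>R v)) u - D (q + \<tau> *\<^sub>R u) u) - s * B v u\<bar> \<le> s * (2 * (\<eta> * (s * N) * norm u))"
      using s by (intro mult_left_mono) auto
    moreover have "\<phi> s - \<phi> 0 - s\<^sup>2 * B v u = s * ((D (q + (\<tau> *\<^sub>R u + s *\<^sub>R v)) u - D (q + \<tau> *\<^sub>R u) u) - s * B v u)"
      unfolding \<tau>(3) by (simp add: power2_eq_square algebra_simps)
    ultimately have "\<bar>\<phi> s - \<phi> 0 - s\<^sup>2 * B v u\<bar> \<le> s * (2 * (\<eta> * (s * N) * norm u))"
      using s by (simp add: abs_mult)
    then show "\<bar>\<rho> (q + s *\<^sub>R u + s *\<^sub>R v) - \<rho> (q + s *\<^sub>R u) - \<rho> (q + s *\<^sub>R v) + \<rho> q - s\<^sup>2 * B v u\<bar>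
       \<le> s\<^sup>2 * (2 * \<eta> * (norm u + norm v) * norm u)"
      by (simp add: \<phi>_def N_def power2_eq_square algebra_simps)
  qed
qed

lemma B_symmetric: "B u v = B v u"
proof -
  have le: "\<bar>B u v - B v u\<bar> \<le> \<eta> * (2 * (norm u + norm v)\<^sup>2)" if \<eta>: "0 < \<eta>" for \<eta>
  proof -
    obtain e1 where e1: "0 < e1" "\<And>s. 0 < s \<Longrightarrow> s < e1 \<Longrightarrow> \<bar>\<rho> (q + s *\<^sub>R u + s *\<^sub>R v) - \<rho> (q + s *\<^sub>R u) - \<rho> (q + s *\<^sub>R v) + \<rho> q - s\<^sup>2 * B v u\<bar>
       \<le> s\<^sup>2 * (2 * \<eta> * (norm u + norm v) * norm u)" using second_difference[OF \<eta>, of u v] by blast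
    obtain e2 where e2: "0 < e2" "\<And>s. 0 < s \<Longrightarrow> s < e2 \<Longrightarrow> \<bar>\<rho> (q + s *\<^sub>R v + s *\<^sub>R u) - \<rho> (q + s *\<^sub>R v) - \<rho> (q + s *\<^sub>R u) + \<rho> q - s\<^sup>2 * B u v\<bar>
       \<le> s\<^sup>2 * (2 * \<eta> * (norm v + norm u) * norm v)" using second_difference[OF \<eta>, of v u] by blast
    define s where "s = min e1 e2 / 2"
    have s: "0 < s" "s < e1" "s < e2" using e1(1) e2(1) by (auto simp: s_def min_def)
    have "q + s *\<^sub>R v + s *\<^sub>R u = q + s *\<^sub>R u + s *\<^sub>R v" by (simp add: algebra_simps)
    with e1(2)[OF s(1,2)] e2(2)[OF s(1,3)]
    have "\<bar>s\<^sup>2 * B u v - s\<^sup>2 * B v u\<bar> \<le> s\<^sup>2 * (2 * \<eta> * (norm u + norm v) * norm u) + s\<^sup>2 * (2 * \<eta> * (norm v + norm u) * norm v)"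
      by simp
    also have "\<dots> = s\<^sup>2 * (\<eta> * (2 * (norm u + norm v)\<^sup>2))" by (simp add: power2_eq_square algebra_simps)
    also have "\<bar>s\<^sup>2 * B u v - s\<^sup>2 * B v u\<bar> = s\<^sup>2 * \<bar>B u v - B v u\<bar>"
      by (simp add: right_diff_distrib[symmetric] abs_mult)
    finally show ?thesis using s(1) by simp
  qed
  have "\<bar>B u v - B v u\<bar> \<le> 0"
  proof (rule tendsto_lowerbound)
    show "((\<lambda>\<eta>. \<eta> * (2 * (norm u + norm v)\<^sup>2)) \<longlongrightarrow> 0) (at_right 0)"
      by (auto intro!: tendsto_eq_intros)
    show "\<forall>\<^sub>F \<eta> in at_right 0. \<bar>B u v - B v u\<bar> \<le> \<eta> * (2 * (norm u + norm v)\<^sup>2)"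
      using le by (auto simp: eventually_at_right_field intro!: exI[of _ 1])
  qed simp
  then show ?thesis by simp
qed

end

section \<open>Levi form and Siegel normal form\<close>

lemma local_defining_function_twice_differentiable:
  assumes "local_defining_function \<Omega> q V \<rho>"
  shows "twice_differentiable \<rho> q V (\<lambda>x. frechet_derivative \<rho> (at x))
    (\<lambda>u v. frechet_derivative (\<lambda>x. frechet_derivative \<rho> (at x) v) (at q) u)"
  unfolding twice_differentiable_def frechet_derivative_works[symmetric]
  using assms by (simp add: local_defining_function_def numeral_2_eq_2)

text \<open>The complex linear functional attached to a real one. Gradient pairing and both sums of
  the Levi form reduce to it, the sum over \<open>j\<close> after conjugation.\<close>

lemma sum_real_linear_complex_components:
  fixes \<phi> :: "complex ^ 'n \<Rightarrow> real"
  assumes "linear \<phi>"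
  shows "(\<Sum>i\<in>UNIV. (of_real (\<phi> (axis i 1)) - \<i> * of_real (\<phi> (axis i \<i>))) * w $ i)
    = of_real (\<phi> w) - \<i> * of_real (\<phi> (\<i> *s w))"
proof -
  have ax: "\<phi> (axis i c) = Re c * \<phi> (axis i 1) + Im c * \<phi> (axis i \<i>)" for i :: 'n and c
  proof -
    have "axis i c = Re c *\<^sub>R axis i 1 + Im c *\<^sub>R axis i \<i>"
      by (auto simp: vec_eq_iff axis_def complex_eq_iff)
    then show ?thesis by (simp add: linear_add[OF assms] linear_cmul[OF assms])
  qed
  have sum: "\<phi> v = (\<Sum>i\<in>UNIV. Re (v $ i) * \<phi> (axis i 1) + Im (v $ i) * \<phi> (axis i \<i>))" for v
  proof -
    have "v = (\<Sum>i\<in>UNIV. axis i (v $ i))"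
      by (simp add: vec_eq_iff axis_def if_distrib cong: if_cong)
    then have "\<phi> v = (\<Sum>i\<in>UNIV. \<phi> (axis i (v $ i)))" by (metis linear_sum[OF assms])
    then show ?thesis by (simp add: ax[of _ "_ $ _"])
  qed
  show ?thesis
    unfolding sum[of w] sum[of "\<i> *s w"]
    by (simp add: complex_eq_iff sum.distrib sum_subtractf sum_negf algebra_simps)
qed

lemma frechet_derivative_of_real:
  assumes "(\<rho> has_derivative D) (at x)"
  shows "frechet_derivative (\<lambda>z. complex_of_real (\<rho> z)) (at x) = (\<lambda>v. of_real (D v))"
  using bounded_linear.has_derivative[OF bounded_linear_of_real assms]
  by (metis frechet_derivative_at)

lemma wirtinger_gradient_pairing:
  assumes "(\<rho> has_derivative D) (at q)"
  shows "(\<Sum>i\<in>UNIV. wirtinger_z i (\<lambda>z. complex_of_real (\<rho> z)) q * w $ i)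
    = (of_real (D w) - \<i> * of_real (D (\<i> *s w))) / 2"
  unfolding sum_real_linear_complex_components[OF has_derivative_linear[OF assms], symmetric]
  by (simp add: wirtinger_z_def frechet_derivative_of_real[OF assms] sum_divide_distrib)

text \<open>The mixed terms \<open>B w (\<i> *s w)\<close> and \<open>B (\<i> *s w) w\<close> cancel
  by symmetry. What remains is a sum of two real Hessian values, whose signs convexity
  controls.\<close>

lemma levi_form_eq:
  fixes \<rho> :: "complex ^ 'n \<Rightarrow> real"
  assumes td: "twice_differentiable \<rho> q V D B"
  shows "levi_form \<rho> q w = of_real ((B w w + B (\<i> *s w) (\<i> *s w)) / 4)"
proof -
  interpret twice_differentiable \<rho> q V D B by (rule td)
  have zbar: "wirtinger_zbar j (\<lambda>z. complex_of_real (\<rho> z)) x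
      = (of_real (D x (axis j 1)) + \<i> * of_real (D x (axis j \<i>))) / 2" if "x \<in> V" for x j
    by (simp add: wirtinger_zbar_def frechet_derivative_of_real[OF D[OF that]])
  have der: "frechet_derivative (wirtinger_zbar j (\<lambda>z. complex_of_real (\<rho> z))) (at q) u
      = (of_real (B u (axis j 1)) + \<i> * of_real (B u (axis j \<i>))) / 2" for u j
  proof -
    have "((\<lambda>x. (of_real (D x (axis j 1)) + \<i> * of_real (D x (axis j \<i>))) / 2) has_derivative
       (\<lambda>u. (of_real (B u (axis j 1)) + \<i> * of_real (B u (axis j \<i>))) / 2)) (at q)"
      by (auto intro!: derivative_eq_intros B bounded_linear.has_derivative[OF bounded_linear_of_real]
               simp: field_simps)
    then have "(wirtinger_zbar j (\<lambda>z. complex_of_real (\<rho> z)) has_derivative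
       (\<lambda>u. (of_real (B u (axis j 1)) + \<i> * of_real (B u (axis j \<i>))) / 2)) (at q)"
      by (rule has_derivative_transform_within_open[OF _ open_V q_in]) (simp add: zbar)
    from frechet_derivative_at[OF this] show ?thesis by (simp add: fun_eq_iff)
  qed
  have inner: "(\<Sum>j\<in>UNIV. (of_real (B u (axis j 1)) + \<i> * of_real (B u (axis j \<i>))) * cnj (w $ j))
      = of_real (B u w) + \<i> * of_real (B u (\<i> *s w))" for u
    using arg_cong[OF sum_real_linear_complex_components[OF linear_B_right[of u], of w], of cnj] by simp
  have wz: "wirtinger_z i (wirtinger_zbar j (\<lambda>z. complex_of_real (\<rho> z))) q =
      ((of_real (B (axis i 1) (axis j 1)) + \<i> * of_real (B (axis i 1) (axis j \<i>)))
      - \<i> * (of_real (B (axis i \<i>) (axis j 1)) + \<i> * of_real (B (axis i \<i>) (axis j \<i>)))) / 4" for i j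
    unfolding wirtinger_z_def der by (simp add: field_simps)
  have "levi_form \<rho> q w = (\<Sum>i\<in>UNIV. (\<Sum>j\<in>UNIV.
      (of_real (B (axis i 1) (axis j 1)) + \<i> * of_real (B (axis i 1) (axis j \<i>))) * cnj (w $ j)
      - \<i> * ((of_real (B (axis i \<i>) (axis j 1)) + \<i> * of_real (B (axis i \<i>) (axis j \<i>))) * cnj (w $ j))) * w $ i) / 4"
    unfolding levi_form_def wz sum_divide_distrib sum_distrib_right
    by (intro sum.cong refl) (simp only: times_divide_eq_left left_diff_distrib mult.assoc mult.commute[of "w $ _"])
  also have "\<dots> = (\<Sum>i\<in>UNIV. ((of_real (B (axis i 1) w) + \<i> * of_real (B (axis i 1) (\<i> *s w)))
      - \<i> * (of_real (B (axis i \<i>) w) + \<i> * of_real (B (axis i \<i>) (\<i> *s w)))) * w $ i) / 4"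
    by (simp only: sum_subtractf sum_distrib_left[symmetric] inner)
  also have "(\<Sum>i\<in>UNIV. ((of_real (B (axis i 1) w) + \<i> * of_real (B (axis i 1) (\<i> *s w)))
      - \<i> * (of_real (B (axis i \<i>) w) + \<i> * of_real (B (axis i \<i>) (\<i> *s w)))) * w $ i)
    = (\<Sum>i\<in>UNIV. (of_real (B (axis i 1) w) - \<i> * of_real (B (axis i \<i>) w)) * w $ i)
      + \<i> * (\<Sum>i\<in>UNIV. (of_real (B (axis i 1) (\<i> *s w)) - \<i> * of_real (B (axis i \<i>) (\<i> *s w))) * w $ i)"
    by (simp add: sum_distrib_left sum.distrib[symmetric] algebra_simps)
  also have "\<dots> = of_real (B w w + B (\<i> *s w) (\<i> *s w))"
    unfolding sum_real_linear_complex_components[OF linear_B_left]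
    by (simp add: algebra_simps B_symmetric[of "\<i> *s w" w])
  finally show ?thesis by simp
qed

text \<open>If the value were negative, two points symmetric about \<open>q\<close> would lie in
  \<open>\<Omega>\<close>, and so would their midpoint \<open>q\<close>.\<close>

lemma (in twice_differentiable) convex_hessian_nonneg:
  assumes conv: "convex \<Omega>" and def: "\<Omega> \<inter> V = {z \<in> V. \<rho> z < 0}" and 0: "\<rho> q = 0"
    and tangent: "D q x = 0"
  shows "0 \<le> B x x"
proof (rule ccontr)
  assume neg: "\<not> 0 \<le> B x x"
  then have x0: "x \<noteq> 0" using linear_0[OF linear_B_right[of x]] by auto
  \<comment> \<open>The Taylor error is then half the size of the term \<open>B x x / 2\<close>,
    which leaves \<open>B x x / 4 < 0\<close>.\<close>
  define \<eta> where "\<eta> = - B x x / (4 * (norm x)\<^sup>2)"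
  have \<eta>: "0 < \<eta>" using neg x0 by (simp add: \<eta>_def divide_neg_pos)
  obtain d where d: "0 < d" "\<And>x. norm x < d \<Longrightarrow> q + x \<in> V"
    "\<And>x. norm x < d \<Longrightarrow> \<bar>\<rho> (q + x) - \<rho> q - D q x - B x x / 2\<bar> \<le> \<eta> * (norm x)\<^sup>2"
    using Taylor_second_order[OF \<eta>] by blast
  define s where "s = d / (2 * norm x)"
  have s: "0 < s" "s * norm x < d" using d x0 by (simp_all add: s_def)
  have in\<Omega>: "q + r *\<^sub>R x \<in> \<Omega>" if r: "\<bar>r\<bar> = s" for r
  proof -
    have n: "norm (r *\<^sub>R x) < d" using s r by simp
    have "\<rho> (q + r *\<^sub>R x) \<le> D q (r *\<^sub>R x) + B (r *\<^sub>R x) (r *\<^sub>R x) / 2 + \<eta> * (norm (r *\<^sub>R x))\<^sup>2"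
      using d(3)[OF n] 0 by linarith
    also have "\<dots> = r\<^sup>2 * (B x x / 2 + \<eta> * (norm x)\<^sup>2)"
      using tangent
      by (simp add: linear_cmul[OF linear_D[OF q_in]] linear_cmul[OF linear_B_left]
          linear_cmul[OF linear_B_right] power2_eq_square algebra_simps)
    also have "B x x / 2 + \<eta> * (norm x)\<^sup>2 = B x x / 4" using x0 by (simp add: \<eta>_def)
    also have "r\<^sup>2 * (B x x / 4) < 0"
      using neg s r by (intro mult_pos_neg) (auto simp: zero_less_power2)
    finally show ?thesis using def d(2)[OF n] by blast
  qed
  have "(1/2) *\<^sub>R (q + s *\<^sub>R x) + (1/2) *\<^sub>R (q + (- s) *\<^sub>R x) \<in> \<Omega>"
    using convexD[OF conv in\<Omega>[of s] in\<Omega>[of "- s"], of "1/2" "1/2"] s by simp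
  also have "(1/2) *\<^sub>R (q + s *\<^sub>R x) + (1/2) *\<^sub>R (q + (- s) *\<^sub>R x) = q"
    by (simp add: algebra_simps flip: scaleR_add_left)
  finally have "\<rho> q < 0" using def q_in by blast
  then show False using 0 by simp
qed

text \<open>First-order contact with the Siegel domain \<open>Re x\<^sub>1 > \<bar>x\<^sub>2\<bar>\<^sup>2 + Re (\<beta> x\<^sub>2\<^sup>2)\<close>, with errors of lower
  order when \<open>x\<^sub>1\<close> is of size \<open>t\<close> and \<open>x\<^sub>2\<close> of size \<open>\<surd>t\<close>.\<close>

definition siegel_contact :: "(complex ^ 2) set \<Rightarrow> complex \<Rightarrow> real \<Rightarrow> bool" where
  "siegel_contact \<Omega> \<beta> C \<longleftrightarrow> (\<forall>\<eta>>0. \<exists>d>0. \<forall>x. cmod (x $ 1) < d \<longrightarrow> cmod (x $ 2) < d \<longrightarrow>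
     (let Q = (cmod (x $ 2))\<^sup>2 + Re (\<beta> * (x $ 2)\<^sup>2);
          E = C * cmod (x $ 1) * (cmod (x $ 1) + cmod (x $ 2)) + \<eta> * (cmod (x $ 2))\<^sup>2
      in (Re (x $ 1) > Q + E \<longrightarrow> x \<in> \<Omega>) \<and> (x \<in> \<Omega> \<longrightarrow> Re (x $ 1) > Q - E)))"

text \<open>Along \<open>a *s n + b *s u\<close> the linear part of \<open>\<rho>\<close> is
  \<open>- Re a\<close> and the quadratic part in \<open>b\<close> has Hermitian coefficient 1. All
  terms containing \<open>a\<close> quadratically or mixed with \<open>b\<close> go into the error
  with constant \<open>C\<close>.\<close>

lemma siegel_contact_normal_form:
  fixes \<rho> :: "complex ^ 2 \<Rightarrow> real"
  assumes conv: "convex \<Omega>" and def: "local_defining_function \<Omega> q V \<rho>"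
    and tangent: "(\<Sum>i\<in>UNIV. wirtinger_z i (\<lambda>z. complex_of_real (\<rho> z)) q * w $ i) = 0"
    and levi: "levi_form \<rho> q w \<noteq> 0"
  shows "\<exists>n u \<beta> C. 0 \<le> C \<and> (\<forall>a b. a *s n + b *s u = 0 \<longrightarrow> a = 0 \<and> b = 0) \<and>
    siegel_contact {x. q + (x $ 1 *s n + x $ 2 *s u) \<in> \<Omega>} \<beta> C"
proof -
  define D where "D x = frechet_derivative \<rho> (at x)" for x
  define B where "B u v = frechet_derivative (\<lambda>x. frechet_derivative \<rho> (at x) v) (at q) u" for u v
  interpret twice_differentiable \<rho> q V D B
    using local_defining_function_twice_differentiable[OF def]
    by (simp add: D_def[abs_def] B_def[abs_def])
  have \<rho>: "\<Omega> \<inter> V = {z \<in> V. \<rho> z < 0}" "\<rho> q = 0" "D q \<noteq> (\<lambda>v. 0)"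
    using def by (auto simp: local_defining_function_def D_def)
  have lD: "linear (D q)" by (rule linear_D[OF q_in])
  \<comment> \<open>Minus twice the complex differential of \<open>\<rho>\<close>: the complex
    linear functional with real part \<open>- D q\<close>.\<close>
  define \<kappa> where "\<kappa> v = - complex_of_real (D q v) + \<i> * of_real (D q (\<i> *s v))" for v
  have Re_\<kappa>: "D q v = - Re (\<kappa> v)" for v by (simp add: \<kappa>_def)
  have \<kappa>_eq: "\<kappa> v = - 2 * (\<Sum>i\<in>UNIV. wirtinger_z i (\<lambda>z. complex_of_real (\<rho> z)) q * v $ i)" for v
    unfolding wirtinger_gradient_pairing[OF D[OF q_in]] by (simp add: \<kappa>_def)
  have \<kappa>_lin: "\<kappa> (u + v) = \<kappa> u + \<kappa> v" "\<kappa> (c *s v) = c * \<kappa> v" for u v c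
    unfolding \<kappa>_eq by (simp_all add: sum.distrib sum_distrib_left algebra_simps)
  have \<kappa>w: "\<kappa> w = 0"
    using tangent unfolding \<kappa>_eq by simp
  obtain x0 where "D q x0 \<noteq> 0" using \<rho>(3) by blast
  then have x0: "\<kappa> x0 \<noteq> 0" by (auto simp: Re_\<kappa>)
  define n where "n = (1 / \<kappa> x0) *s x0"
  have \<kappa>n: "\<kappa> n = 1" using x0 by (simp add: n_def \<kappa>_lin)
  define \<Lambda> where "\<Lambda> = (B w w + B (\<i> *s w) (\<i> *s w)) / 4"
  have "\<Lambda> \<noteq> 0"
    using levi unfolding levi_form_eq[OF twice_differentiable_axioms] \<Lambda>_def of_real_eq_0_iff .
  moreover have "0 \<le> B w w" "0 \<le> B (\<i> *s w) (\<i> *s w)"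
    using convex_hessian_nonneg[OF conv \<rho>(1,2)] \<kappa>w by (simp_all add: Re_\<kappa> \<kappa>_lin)
  ultimately have \<Lambda>: "0 < \<Lambda>" by (simp add: \<Lambda>_def)
  define u where "u = complex_of_real (1 / sqrt \<Lambda>) *s w"
  have \<kappa>u: "\<kappa> u = 0" by (simp add: u_def \<kappa>_lin \<kappa>w)
  have u_scale: "u = (1 / sqrt \<Lambda>) *\<^sub>R w" "\<i> *s u = (1 / sqrt \<Lambda>) *\<^sub>R (\<i> *s w)"
    unfolding u_def vector_smult_of_real[symmetric] by (simp_all add: vec_eq_iff)
  have levi_u: "(B u u + B (\<i> *s u) (\<i> *s u)) / 4 = 1"
  proof -
    have "B u u = B w w / \<Lambda>" "B (\<i> *s u) (\<i> *s u) = B (\<i> *s w) (\<i> *s w) / \<Lambda>"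
      unfolding u_scale(2) unfolding u_scale(1) using \<Lambda>
      by (simp_all add: linear_cmul[OF linear_B_left] linear_cmul[OF linear_B_right])
    then have "(B u u + B (\<i> *s u) (\<i> *s u)) / 4 = \<Lambda> / \<Lambda>"
      by (metis (no_types, opaque_lifting) \<Lambda>_def add_divide_distrib divide_divide_eq_left mult.commute)
    then show ?thesis using \<Lambda> by simp
  qed
  \<comment> \<open>A real quadratic form on the line spanned by \<open>u\<close> is a Hermitian
    part plus the real part of a complex square; \<open>\<beta>\<close> is the coefficient of that
    square.\<close>
  define \<beta> where "\<beta> = Complex ((B u u - B (\<i> *s u) (\<i> *s u)) / 4) (- B u (\<i> *s u) / 2)"
  have Bu: "B (b *s u) (b *s u) / 2 = (cmod b)\<^sup>2 + Re (\<beta> * b\<^sup>2)" for b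
  proof -
    have "b *s u = Re b *\<^sub>R u + Im b *\<^sub>R (\<i> *s u)"
      by (simp add: vec_eq_iff complex_eq_iff)
    then have "B (b *s u) (b *s u) = (Re b)\<^sup>2 * B u u + 2 * Re b * Im b * B u (\<i> *s u) + (Im b)\<^sup>2 * B (\<i> *s u) (\<i> *s u)"
      by (simp add: linear_cmul[OF linear_B_left] linear_cmul[OF linear_B_right] linear_add[OF linear_B_left]
          linear_add[OF linear_B_right] B_symmetric[of "\<i> *s u" u] power2_eq_square algebra_simps)
    moreover have "Re (\<beta> * b\<^sup>2) = (B u u - B (\<i> *s u) (\<i> *s u)) / 4 * ((Re b)\<^sup>2 - (Im b)\<^sup>2)
        + B u (\<i> *s u) * Re b * Im b"
      by (simp add: \<beta>_def Re_power2 Im_power2)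
    moreover have eq: "B (\<i> *s u) (\<i> *s u) = 4 - B u u" using levi_u by simp
    ultimately show ?thesis
      unfolding cmod_power2 eq by (simp add: field_simps)
  qed
  obtain K where K: "0 < K" "\<And>x y. norm (B x y) \<le> K * norm x * norm y"
    using bilinear_bounded_pos[OF bilinear_B] by blast
  \<comment> \<open>The products bound the Hessian terms containing \<open>n\<close>; the summand 1
    absorbs the part \<open>(cmod a)\<^sup>2\<close> of the Taylor remainder.\<close>
  define C where "C = K * norm n * norm n + K * norm n * norm u + 1"
  have C: "0 \<le> C" using K by (simp add: C_def)
  have indep: "a = 0 \<and> b = 0" if "a *s n + b *s u = 0" for a b
  proof -
    have "\<kappa> (a *s n + b *s u) = \<kappa> (0 *s n)" using that by simp
    then have a: "a = 0" by (simp only: \<kappa>_lin \<kappa>n \<kappa>u) simp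
    have "u \<noteq> 0" using levi_u linear_0[OF linear_B_left] by auto
    with that a show ?thesis by (auto simp: vec_eq_iff)
  qed
  have "siegel_contact {x. q + (x $ 1 *s n + x $ 2 *s u) \<in> \<Omega>} \<beta> C"
    unfolding siegel_contact_def
  proof (intro allI impI)
    fix \<eta> :: real assume \<eta>: "0 < \<eta>"
    define P where "P = norm n + norm u + 1"
    have P: "1 \<le> P" "norm n \<le> P" "norm u \<le> P" by (simp_all add: P_def)
    \<comment> \<open>Chosen against \<open>(norm y)\<^sup>2 \<le> 2 * P\<^sup>2 * ((cmod a)\<^sup>2
      + (cmod b)\<^sup>2)\<close>; the minimum with 1 serves the term in \<open>a\<close>.\<close>
    define \<eta>' where "\<eta>' = min 1 \<eta> / (2 * P\<^sup>2)"
    have \<eta>': "0 < \<eta>'" using \<eta> P by (simp add: \<eta>'_def)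
    obtain d where d: "0 < d" "\<And>x. norm x < d \<Longrightarrow> q + x \<in> V"
      "\<And>x. norm x < d \<Longrightarrow> \<bar>\<rho> (q + x) - \<rho> q - D q x - B x x / 2\<bar> \<le> \<eta>' * (norm x)\<^sup>2"
      using Taylor_second_order[OF \<eta>'] by blast
    show "\<exists>d>0. \<forall>x :: complex ^ 2. cmod (x $ 1) < d \<longrightarrow> cmod (x $ 2) < d \<longrightarrow>
       (let Q = (cmod (x $ 2))\<^sup>2 + Re (\<beta> * (x $ 2)\<^sup>2);
            E = C * cmod (x $ 1) * (cmod (x $ 1) + cmod (x $ 2)) + \<eta> * (cmod (x $ 2))\<^sup>2
        in (Re (x $ 1) > Q + E \<longrightarrow> x \<in> {x. q + (x $ 1 *s n + x $ 2 *s u) \<in> \<Omega>}) \<and>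
           (x \<in> {x. q + (x $ 1 *s n + x $ 2 *s u) \<in> \<Omega>} \<longrightarrow> Re (x $ 1) > Q - E))"
    proof (rule exI[of _ "d / (2 * P)"], intro conjI allI impI)
      show "0 < d / (2 * P)" using d P by simp
      fix x :: "complex ^ 2" assume x: "cmod (x $ 1) < d / (2 * P)" "cmod (x $ 2) < d / (2 * P)"
      define a where "a = x $ 1"
      define b where "b = x $ 2"
      define y where "y = a *s n + b *s u"
      have ny: "norm y \<le> P * (cmod a + cmod b)"
      proof -
        have "norm y \<le> cmod a * norm n + cmod b * norm u"
          unfolding y_def using norm_triangle_ineq[of "a *s n" "b *s u"] by (simp add: norm_vector_smult)
        also have "\<dots> \<le> cmod a * P + cmod b * P"
          using P by (intro add_mono mult_left_mono) auto
        finally show ?thesis by (simp add: algebra_simps)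
      qed
      have "P * (cmod a + cmod b) < d" using x P by (simp add: a_def b_def field_simps)
      then have y: "norm y < d" using ny by linarith
      have Dy: "D q y = - Re a" by (simp add: Re_\<kappa> y_def \<kappa>_lin \<kappa>n \<kappa>u)
      define E1 where "E1 = B (a *s n) (a *s n) / 2 + B (a *s n) (b *s u)"
      have By: "B y y / 2 = E1 + (cmod b)\<^sup>2 + Re (\<beta> * b\<^sup>2)"
        using Bu[of b] unfolding y_def E1_def
        by (simp add: linear_add[OF linear_B_left] linear_add[OF linear_B_right]
            B_symmetric[of "b *s u" "a *s n"])
      have E1: "\<bar>E1\<bar> \<le> K * norm n * norm n * (cmod a)\<^sup>2 + K * norm n * norm u * (cmod a * cmod b)"
      proof -
        have "\<bar>B (a *s n) (a *s n)\<bar> \<le> K * norm n * norm n * (cmod a)\<^sup>2"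
          using K(2)[of "a *s n" "a *s n"] by (simp add: norm_vector_smult power2_eq_square mult_ac)
        moreover have "\<bar>B (a *s n) (b *s u)\<bar> \<le> K * norm n * norm u * (cmod a * cmod b)"
          using K(2)[of "a *s n" "b *s u"] by (simp add: norm_vector_smult mult_ac)
        ultimately show ?thesis unfolding E1_def by linarith
      qed
      have E2: "\<eta>' * (norm y)\<^sup>2 \<le> (cmod a)\<^sup>2 + \<eta> * (cmod b)\<^sup>2"
      proof -
        have "(norm y)\<^sup>2 \<le> (P * (cmod a + cmod b))\<^sup>2" using ny by (intro power_mono) auto
        also have "\<dots> \<le> P\<^sup>2 * (2 * ((cmod a)\<^sup>2 + (cmod b)\<^sup>2))"
          unfolding power_mult_distrib
          using sum_squares_bound[of "cmod a" "cmod b"]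
          by (intro mult_left_mono) (auto simp: power2_sum)
        finally have "\<eta>' * (norm y)\<^sup>2 \<le> \<eta>' * (P\<^sup>2 * (2 * ((cmod a)\<^sup>2 + (cmod b)\<^sup>2)))"
          using \<eta>' by (intro mult_left_mono) auto
        also have "\<dots> = min 1 \<eta> * (cmod a)\<^sup>2 + min 1 \<eta> * (cmod b)\<^sup>2"
          using P by (simp add: \<eta>'_def field_simps)
        also have "\<dots> \<le> 1 * (cmod a)\<^sup>2 + \<eta> * (cmod b)\<^sup>2"
          by (intro add_mono mult_right_mono) auto
        finally show ?thesis by simp
      qed
      define Q where "Q = (cmod b)\<^sup>2 + Re (\<beta> * b\<^sup>2)"
      define E where "E = C * cmod a * (cmod a + cmod b) + \<eta> * (cmod b)\<^sup>2"
      have "K * norm n * norm n * (cmod a)\<^sup>2 + K * norm n * norm u * (cmod a * cmod b)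
          + (cmod a)\<^sup>2 \<le> C * cmod a * (cmod a + cmod b)"
      proof -
        have "0 \<le> K * norm n * norm u * (cmod a)\<^sup>2" "0 \<le> (K * norm n * norm n + 1) * (cmod a * cmod b)"
          using K by simp_all
        then show ?thesis by (simp add: C_def power2_eq_square algebra_simps)
      qed
      then have "\<bar>\<rho> (q + y) - (- Re a + Q)\<bar> \<le> E"
        using d(3)[OF y] E1 E2 unfolding \<rho>(2) Dy By Q_def E_def by linarith
      moreover have "q + y \<in> \<Omega> \<longleftrightarrow> \<rho> (q + y) < 0" using \<rho>(1) d(2)[OF y] by blast
      ultimately have "(Re a > Q + E \<longrightarrow> q + y \<in> \<Omega>) \<and> (q + y \<in> \<Omega> \<longrightarrow> Re a > Q - E)"
        by linarith
      then show "let Q = (cmod (x $ 2))\<^sup>2 + Re (\<beta> * (x $ 2)\<^sup>2);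
            E = C * cmod (x $ 1) * (cmod (x $ 1) + cmod (x $ 2)) + \<eta> * (cmod (x $ 2))\<^sup>2
        in (Re (x $ 1) > Q + E \<longrightarrow> x \<in> {x. q + (x $ 1 *s n + x $ 2 *s u) \<in> \<Omega>}) \<and>
           (x \<in> {x. q + (x $ 1 *s n + x $ 2 *s u) \<in> \<Omega>} \<longrightarrow> Re (x $ 1) > Q - E)"
        unfolding Let_def mem_Collect_eq y_def Q_def E_def a_def b_def .
    qed
  qed
  with C indep show ?thesis by blast
qed

section \<open>Comparison with the ball\<close>

lemma holomorphic_fun_on_const [intro]: "holomorphic_fun_on (\<lambda>x. c) S"
  unfolding holomorphic_fun_on_def by (intro ballI exI[of _ "\<lambda>v. 0"]) simp

lemma holomorphic_fun_on_nth [intro]: "holomorphic_fun_on (\<lambda>x. x $ i) S"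
  unfolding holomorphic_fun_on_def
  by (intro ballI exI[of _ "\<lambda>v. v $ i"]) (simp add: bounded_linear.has_derivative[OF bounded_linear_vec_nth has_derivative_ident])

lemma holomorphic_fun_on_mult [intro]:
  "holomorphic_fun_on a S \<Longrightarrow> holomorphic_fun_on b S \<Longrightarrow> holomorphic_fun_on (\<lambda>x. a x * b x) S"
  using holomorphic_fun_on_diff_prod[of a S b "\<lambda>x. 0" "\<lambda>x. 0"] by (simp add: holomorphic_fun_on_const)

lemma holomorphic_fun_on_diff [intro]:
  "holomorphic_fun_on a S \<Longrightarrow> holomorphic_fun_on b S \<Longrightarrow> holomorphic_fun_on (\<lambda>x. a x - b x) S"
  using holomorphic_fun_on_diff_prod[of a S "\<lambda>x. 1" b "\<lambda>x. 1"] by (simp add: holomorphic_fun_on_const)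

lemma holomorphic_fun_on_add [intro]:
  "holomorphic_fun_on a S \<Longrightarrow> holomorphic_fun_on b S \<Longrightarrow> holomorphic_fun_on (\<lambda>x. a x + b x) S"
  using holomorphic_fun_on_diff_prod[of a S "\<lambda>x. 1" b "\<lambda>x. - 1"] by (simp add: holomorphic_fun_on_const)

lemma holomorphic_fun_on_divide [intro]:
  assumes "holomorphic_fun_on a S" "holomorphic_fun_on b S" and nz: "\<And>x. x \<in> S \<Longrightarrow> b x \<noteq> 0"
  shows "holomorphic_fun_on (\<lambda>x. a x / b x) S"
proof -
  have "holomorphic_fun_on (\<lambda>x. inverse (b x)) S"
    unfolding holomorphic_fun_on_def
  proof
    fix z assume z: "z \<in> S"
    note b = holomorphic_fun_on_frechet[OF assms(2) z]
    have "((\<lambda>x. inverse (b x)) has_derivative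
        (\<lambda>h. - (inverse (b z) * frechet_derivative b (at z) h * inverse (b z)))) (at z)"
      using nz[OF z] b(1) by (rule Deriv.has_derivative_inverse)
    then show "\<exists>L. ((\<lambda>x. inverse (b x)) has_derivative L) (at z) \<and> (\<forall>c v. L (c *s v) = c * L v)"
      by (rule_tac exI, intro conjI allI, assumption) (simp add: b(2) algebra_simps)
  qed
  from holomorphic_fun_on_mult[OF assms(1) this] show ?thesis by (simp add: divide_inverse)
qed

lemma cmod_diff_le_cmod_add:
  assumes "0 \<le> Re u" "0 < \<tau>"
  shows "cmod (u - of_real \<tau>) \<le> cmod (u + of_real \<tau>)"
proof -
  have "(cmod (u + of_real \<tau>))\<^sup>2 = (cmod (u - of_real \<tau>))\<^sup>2 + 4 * \<tau> * Re u"
    unfolding cmod_power2 by (simp add: power2_eq_square algebra_simps)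
  then show ?thesis using assms by - (rule power2_le_imp_le, auto)
qed

text \<open>The Cayley transform of \<open>u\<close> maps into the unit disk and vanishes at
  \<open>z\<close>. The Schwarz lemma bounds it by \<open>r / s\<close>, and solving for
  \<open>cmod (u x)\<close> gives Harnack's quotient.\<close>

lemma (in injective_holomorphic) Harnack_inverse:
  assumes u: "holomorphic_fun_on u {x \<in> \<Omega>. f x \<in> polydisk s}"
    and pos: "\<And>x. x \<in> \<Omega> \<Longrightarrow> f x \<in> polydisk s \<Longrightarrow> 0 \<le> Re (u x)"
    and z: "z \<in> \<Omega>" "f z = 0" "u z = of_real \<tau>" "0 < \<tau>"
    and x: "x \<in> \<Omega>" "sup_norm2 (f x) \<le> r" and r: "r < s"
  shows "cmod (u x) * (s - r) \<le> \<tau> * (s + r)"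
proof -
  have nz: "u x + of_real \<tau> \<noteq> 0" if "x \<in> \<Omega>" "f x \<in> polydisk s" for x
    using pos[OF that] z(4) by (auto simp: complex_eq_iff)
  have xs: "f x \<in> polydisk s" using x r by (simp add: polydisk_iff_sup_norm2)
  have "cmod ((u x - of_real \<tau>) / (u x + of_real \<tau>)) \<le> 1 / s * sup_norm2 (f x)"
  proof (rule Schwarz_inverse[where h = "\<lambda>x. (u x - of_real \<tau>) / (u x + of_real \<tau>)" and z = z])
    show "holomorphic_fun_on (\<lambda>x. (u x - of_real \<tau>) / (u x + of_real \<tau>)) {x \<in> \<Omega>. f x \<in> polydisk s}"
      using u nz by (intro holomorphic_fun_on_divide holomorphic_fun_on_diff holomorphic_fun_on_add holomorphic_fun_on_const) auto
    show "cmod ((u x - of_real \<tau>) / (u x + of_real \<tau>)) \<le> 1" if "x \<in> \<Omega>" "f x \<in> polydisk s" for x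
      using cmod_diff_le_cmod_add[OF pos[OF that] z(4)] nz[OF that] by (simp add: norm_divide)
  qed (use z x xs in auto)
  also have "\<dots> \<le> 1 / s * r" using x s_pos by (intro mult_left_mono) auto
  finally have "cmod (u x - of_real \<tau>) * s \<le> r * cmod (u x + of_real \<tau>)"
    using nz[OF x(1) xs] s_pos by (simp add: norm_divide field_simps)
  moreover have "cmod (u x) - \<tau> \<le> cmod (u x - of_real \<tau>)"
    using norm_triangle_ineq2[of "u x" "of_real \<tau>"] z(4) by simp
  then have "(cmod (u x) - \<tau>) * s \<le> cmod (u x - of_real \<tau>) * s"
    using s_pos by (intro mult_right_mono) auto
  moreover have "r * cmod (u x + of_real \<tau>) \<le> r * (cmod (u x) + \<tau>)"
    using norm_triangle_ineq[of "u x" "of_real \<tau>"] z(4) order_trans[OF sup_norm2_nonneg x(2)]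
    by (intro mult_left_mono) auto
  ultimately show ?thesis by (simp add: algebra_simps)
qed

lemma (in injective_holomorphic) smaller_polydisk:
  assumes "0 < r" "r \<le> s"
  shows "injective_holomorphic f \<Omega> r"
proof -
  have "polydisk r \<subseteq> (polydisk s :: (complex ^ 2) set)" using assms by (auto simp: polydisk_iff_sup_norm2)
  then show ?thesis
    using open_\<Omega> hol inj image assms(1) by (unfold_locales) auto
qed

text \<open>The Cayley map \<open>((w - t) / (w + t), 2 \<surd>t b / (w + t))\<close> sends \<open>Re w > \<bar>b\<bar>\<^sup>2\<close> onto the unit ball.\<close>

lemma Cayley_functional_bound:
  fixes w b A B :: complex
  assumes t: "0 < t" and w: "(cmod b)\<^sup>2 - t / 100 \<le> Re w" and AB: "(cmod A)\<^sup>2 + (cmod B)\<^sup>2 \<le> 1"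
  shows "cmod ((A * (w - of_real t) + 2 * B * of_real (sqrt t) * b) / (w + of_real t)) \<le> 11 / 10"
proof -
  define P where "P = cmod (w - of_real t)"
  define Q where "Q = 2 * sqrt t * cmod b"
  define N where "N = cmod (w + of_real t)"
  have Re_w: "- t / 100 \<le> Re w" using w zero_le_power2[of "cmod b"] by linarith
  have N: "t * (99 / 100) \<le> N"
    using complex_Re_le_cmod[of "w + of_real t"] Re_w by (simp add: N_def)
  \<comment> \<open>Together with \<open>Q2\<close> this gives \<open>P\<^sup>2 + Q\<^sup>2 =
    N\<^sup>2 + 4 * t * ((cmod b)\<^sup>2 - Re w)\<close>. As \<open>N\<close> is at least
    \<open>99/100 * t\<close>, the slack \<open>t / 100\<close> costs less than the factor
    11/10.\<close>
  have P2: "P\<^sup>2 = N\<^sup>2 - 4 * t * Re w"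
    unfolding P_def N_def cmod_power2 by (simp add: power2_eq_square algebra_simps)
  have Q2: "Q\<^sup>2 = 4 * t * (cmod b)\<^sup>2" using t by (simp add: Q_def power_mult_distrib)
  have "(cmod A * P + cmod B * Q)\<^sup>2 \<le> ((cmod A)\<^sup>2 + (cmod B)\<^sup>2) * (P\<^sup>2 + Q\<^sup>2)"
  proof -
    have "((cmod A)\<^sup>2 + (cmod B)\<^sup>2) * (P\<^sup>2 + Q\<^sup>2) = (cmod A * P + cmod B * Q)\<^sup>2 + (cmod A * Q - cmod B * P)\<^sup>2"
      by (simp add: power2_eq_square algebra_simps)
    then show ?thesis by simp
  qed
  also have "\<dots> \<le> 1 * (P\<^sup>2 + Q\<^sup>2)" using AB by (intro mult_right_mono) auto
  also have "\<dots> = N\<^sup>2 + 4 * t * ((cmod b)\<^sup>2 - Re w)" by (simp add: P2 Q2 algebra_simps)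
  also have "4 * t * ((cmod b)\<^sup>2 - Re w) \<le> 4 * t * (t / 100)"
    using w t by (intro mult_left_mono) auto
  also have "N\<^sup>2 + 4 * t * (t / 100) \<le> (11 / 10 * N)\<^sup>2"
  proof -
    have "(t * (99 / 100))\<^sup>2 \<le> N\<^sup>2" using N t by (intro power_mono) auto
    then have "t\<^sup>2 * (9801 / 10000) \<le> N\<^sup>2" by (simp add: power_mult_distrib power2_eq_square)
    moreover have "(11 / 10 * N)\<^sup>2 = N\<^sup>2 * (121 / 100)" "4 * t * (t / 100) = t\<^sup>2 * (4 / 100)"
      by (simp_all add: power2_eq_square)
    moreover have "0 \<le> t\<^sup>2" by simp
    ultimately show ?thesis by linarith
  qed
  finally have "(cmod A * P + cmod B * Q)\<^sup>2 \<le> (11 / 10 * N)\<^sup>2" by simp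
  then have "cmod A * P + cmod B * Q \<le> 11 / 10 * N"
    using N t by - (rule power2_le_imp_le, auto)
  moreover have "cmod (A * (w - of_real t) + 2 * B * of_real (sqrt t) * b) \<le> cmod A * P + cmod B * Q"
    using norm_triangle_ineq[of "A * (w - of_real t)" "2 * B * of_real (sqrt t) * b"] t
    by (simp add: norm_mult P_def Q_def mult_ac)
  ultimately show ?thesis using N t by (simp add: norm_divide N_def[symmetric] field_simps)
qed

text \<open>The norm of the infinitesimal ball at the base point \<open>(t, 0)\<close> in the Siegel domain.\<close>

definition siegel_norm :: "real \<Rightarrow> complex ^ 2 \<Rightarrow> real" where
  "siegel_norm t v = sqrt ((cmod (v $ 1 / (2 * of_real t)))\<^sup>2 + (cmod (v $ 2 / of_real (sqrt t)))\<^sup>2)"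

lemma siegel_norm_nonneg: "0 \<le> siegel_norm t v"
  by (simp add: siegel_norm_def)

lemma siegel_norm_eq_0: "0 < t \<Longrightarrow> siegel_norm t v = 0 \<Longrightarrow> v = 0"
  by (auto simp: siegel_norm_def vec_eq_iff forall_2 add_nonneg_eq_0_iff)

lemma siegel_norm_parallelogram:
  "(siegel_norm t (u + v))\<^sup>2 + (siegel_norm t (u - v))\<^sup>2 = 2 * (siegel_norm t u)\<^sup>2 + 2 * (siegel_norm t v)\<^sup>2"
  unfolding siegel_norm_def
  by (simp add: add_divide_distrib diff_divide_distrib cmod_power2)
     (simp add: power2_eq_square algebra_simps)

text \<open>For linear \<open>L\<close> the indicatrix \<open>sup_norm2 (L v) \<le> 1\<close> is a bidisk, whose norm violates the
  parallelogram law; hence it is not close to the Hilbert norm \<open>siegel_norm\<close>.\<close>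

lemma bidisk_norm_not_Hilbert:
  assumes t: "0 < t" and L: "linear L"
    and lower: "\<And>v. siegel_norm t v \<le> 11 / 9 * sup_norm2 (L v)"
    and upper: "\<And>v. sup_norm2 (L v) \<le> 10 / 9 * siegel_norm t v"
  shows False
proof -
  have "inj L"
    unfolding linear_injective_0[OF L]
  proof (intro allI impI)
    fix v assume "L v = 0"
    then have "siegel_norm t v \<le> 0" using lower[of v] sup_norm2_eq_0_iff[of "L v"] by simp
    then show "v = 0" using siegel_norm_eq_0[OF t] siegel_norm_nonneg[of t v] by simp
  qed
  then have surj: "surj L" using linear_injective_imp_surjective[OF L] by simp
  \<comment> \<open>In the bidisk norm both basis vectors, their sum and their difference have
    length 1. The two bounds make one side of the parallelogram law at most
    \<open>2 * (11/9)^2 < 3\<close> and the other at least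
    \<open>4 * (9/10)^2 = 3.24\<close>.\<close>
  obtain v1 where v1: "L v1 = axis 1 1" using surj by (metis surj_def)
  obtain v2 where v2: "L v2 = axis 2 1" using surj by (metis surj_def)
  have "sup_norm2 (L v1) = 1" "sup_norm2 (L v2) = 1" "sup_norm2 (L (v1 + v2)) = 1" "sup_norm2 (L (v1 - v2)) = 1"
    by (simp_all add: linear_add[OF L] linear_diff[OF L] v1 v2 sup_norm2_def axis_def)
  with upper[of v1] upper[of v2] lower[of "v1 + v2"] lower[of "v1 - v2"]
  have le: "9 / 10 \<le> siegel_norm t v1" "9 / 10 \<le> siegel_norm t v2"
    "siegel_norm t (v1 + v2) \<le> 11 / 9" "siegel_norm t (v1 - v2) \<le> 11 / 9" by auto
  have "(9 / 10)\<^sup>2 \<le> (siegel_norm t v1)\<^sup>2" "(9 / 10)\<^sup>2 \<le> (siegel_norm t v2)\<^sup>2"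
    "(siegel_norm t (v1 + v2))\<^sup>2 \<le> (11 / 9)\<^sup>2" "(siegel_norm t (v1 - v2))\<^sup>2 \<le> (11 / 9)\<^sup>2"
    using le siegel_norm_nonneg by (auto intro!: power_mono)
  with siegel_norm_parallelogram[of t v1 v2] show False by (simp add: power2_eq_square)
qed

section \<open>Convex domains in contact with the Siegel domain: global bounds and
  localization\<close>

definition siegel_base :: "real \<Rightarrow> complex ^ 2" where
  "siegel_base t = axis 1 (of_real t)"

lemma siegel_base_nth [simp]: "siegel_base t $ 1 = of_real t" "siegel_base t $ 2 = 0"
  by (simp_all add: siegel_base_def axis_def)

locale convex_siegel_contact =
  fixes \<Omega> :: "(complex ^ 2) set" and \<beta> :: complex and C :: real
  assumes open_\<Omega>: "open \<Omega>" and convex_\<Omega>: "convex \<Omega>" and bounded_\<Omega>: "bounded \<Omega>"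
    and contact: "siegel_contact \<Omega> \<beta> C" and C_nonneg: "0 \<le> C"
begin

lemma contactE:
  assumes "0 < \<eta>"
  obtains d where "0 < d"
    "\<And>x. cmod (x $ 1) < d \<Longrightarrow> cmod (x $ 2) < d \<Longrightarrow>
       Re (x $ 1) > (cmod (x $ 2))\<^sup>2 + Re (\<beta> * (x $ 2)\<^sup>2) +
         (C * cmod (x $ 1) * (cmod (x $ 1) + cmod (x $ 2)) + \<eta> * (cmod (x $ 2))\<^sup>2) \<Longrightarrow> x \<in> \<Omega>"
    "\<And>x. cmod (x $ 1) < d \<Longrightarrow> cmod (x $ 2) < d \<Longrightarrow> x \<in> \<Omega> \<Longrightarrow>
       Re (x $ 1) > (cmod (x $ 2))\<^sup>2 + Re (\<beta> * (x $ 2)\<^sup>2) -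
         (C * cmod (x $ 1) * (cmod (x $ 1) + cmod (x $ 2)) + \<eta> * (cmod (x $ 2))\<^sup>2)"
  using contact assms unfolding siegel_contact_def Let_def by blast

lemma eventually_base_in: "\<forall>\<^sub>F t in at_right 0. siegel_base t \<in> \<Omega>"
proof -
  obtain d where d: "0 < d" "\<And>x. cmod (x $ 1) < d \<Longrightarrow> cmod (x $ 2) < d \<Longrightarrow>
       Re (x $ 1) > (cmod (x $ 2))\<^sup>2 + Re (\<beta> * (x $ 2)\<^sup>2) +
         (C * cmod (x $ 1) * (cmod (x $ 1) + cmod (x $ 2)) + 1 * (cmod (x $ 2))\<^sup>2) \<Longrightarrow> x \<in> \<Omega>"
    using contactE[of 1] by (metis zero_less_one)
  have "\<forall>\<^sub>F t in at_right 0. C * t < 1"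
    by (rule order_tendstoD(2)[of _ 0]) (auto intro!: tendsto_eq_intros)
  moreover have "\<forall>\<^sub>F t in at_right 0. t < d" using d(1) by (intro order_tendstoD(2)[of _ 0]) (auto intro!: tendsto_eq_intros)
  moreover have "\<forall>\<^sub>F t::real in at_right 0. 0 < t" by (simp add: eventually_at_right_less)
  ultimately show ?thesis
  proof eventually_elim
    case (elim t)
    have "C * t * t < 1 * t" using elim by (intro mult_strict_right_mono) auto
    then show ?case using elim d(1) by (intro d(2)) (auto simp: mult.assoc)
  qed
qed

text \<open>The base points tend to 0, so 0 is in the closure; an open convex set is preserved by
  shrinking towards a point of its closure.\<close>

lemma scaleR_in:
  assumes x: "x \<in> \<Omega>" and e: "0 < e" "e \<le> 1"
  shows "e *\<^sub>R x \<in> \<Omega>"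
proof -
  have "(siegel_base \<longlongrightarrow> 0) (at_right 0)"
    unfolding siegel_base_def
    by (rule vec_tendstoI, case_tac "i = 1") (auto simp: axis_def intro!: tendsto_eq_intros)
  then have "0 \<in> closure \<Omega>"
    unfolding closure_iff_nhds_not_empty
  proof (intro allI impI)
    fix A V :: "(complex ^ 2) set" assume lim: "(siegel_base \<longlongrightarrow> 0) (at_right 0)" and V: "V \<subseteq> A" "open V" "0 \<in> V"
    have "\<forall>\<^sub>F t in at_right 0. siegel_base t \<in> V \<inter> \<Omega>"
      using topological_tendstoD[OF lim V(2,3)] eventually_base_in by eventually_elim auto
    then obtain t where "siegel_base t \<in> V \<inter> \<Omega>"
      using eventually_happens trivial_limit_at_right_real by blast
    then show "\<Omega> \<inter> A \<noteq> {}" using V by auto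
  qed
  from mem_interior_closure_convex_shrink[OF convex_\<Omega> _ this e, of x] x open_\<Omega>
  show ?thesis by (simp add: interior_open)
qed

text \<open>Contact holds only near 0, but shrinking by \<open>e \<le> \<theta>\<close> brings every
  point of \<open>\<Omega>\<close> there. The expression \<open>S\<close> scales quadratically and
  \<open>Re (x $ 1)\<close> linearly, so contact at \<open>e *\<^sub>R x\<close> reads
  \<open>e * S x < Re (x $ 1)\<close>. Taking \<open>e = \<theta>\<close> gives one bound,
  \<open>e\<close> tending to 0 the other.\<close>

lemma global_bound:
  obtains \<theta> where "0 < \<theta>" "\<theta> \<le> 1"
    "\<And>x. x \<in> \<Omega> \<Longrightarrow> 0 \<le> Re (x $ 1)"
    "\<And>x. x \<in> \<Omega> \<Longrightarrow> Re (x $ 1) \<ge> \<theta> * ((cmod (x $ 2))\<^sup>2 / 2 + Re (\<beta> * (x $ 2)\<^sup>2) -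
         C * cmod (x $ 1) * (cmod (x $ 1) + cmod (x $ 2)))"
proof -
  obtain d where d: "0 < d" "\<And>x. cmod (x $ 1) < d \<Longrightarrow> cmod (x $ 2) < d \<Longrightarrow> x \<in> \<Omega> \<Longrightarrow>
       Re (x $ 1) > (cmod (x $ 2))\<^sup>2 + Re (\<beta> * (x $ 2)\<^sup>2) -
         (C * cmod (x $ 1) * (cmod (x $ 1) + cmod (x $ 2)) + 1/2 * (cmod (x $ 2))\<^sup>2)"
    using contactE[of "1/2"] by (metis half_gt_zero zero_less_one)
  obtain R where R: "0 < R" "\<And>x. x \<in> \<Omega> \<Longrightarrow> norm x \<le> R"
    using bounded_\<Omega> unfolding bounded_pos by blast
  define \<theta> where "\<theta> = min 1 (d / (2 * R))"
  define S where "S x = (cmod (x $ 2))\<^sup>2 / 2 + Re (\<beta> * (x $ 2)\<^sup>2) -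
         C * cmod (x $ 1) * (cmod (x $ 1) + cmod (x $ 2))" for x :: "complex ^ 2"
  have \<theta>: "0 < \<theta>" "\<theta> \<le> 1" using d R by (auto simp: \<theta>_def)
  have main: "e * S x \<le> Re (x $ 1)" if x: "x \<in> \<Omega>" and e: "0 < e" "e \<le> \<theta>" for x e
  proof -
    have small: "cmod ((e *\<^sub>R x) $ i) < d" for i
    proof -
      have "cmod ((e *\<^sub>R x) $ i) \<le> e * norm x" using Finite_Cartesian_Product.norm_nth_le[of "e *\<^sub>R x" i] e by simp
      also have "\<dots> \<le> d / (2 * R) * R" using e R(2)[OF x] R(1) by (intro mult_mono) (auto simp: \<theta>_def)
      also have "\<dots> < d" using d R by simp
      finally show ?thesis .
    qed
    have "e *\<^sub>R x \<in> \<Omega>" using scaleR_in[OF x e(1)] e \<theta> by simp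
    note lt = d(2)[OF small small this]
    have cmp: "Re ((e *\<^sub>R x) $ i) = e * Re (x $ i)" "cmod ((e *\<^sub>R x) $ i) = e * cmod (x $ i)" for i
      using e by simp_all
    have "Re (\<beta> * ((e *\<^sub>R x) $ 2)\<^sup>2) = e * (e * Re (\<beta> * (x $ 2)\<^sup>2))"
      by (simp only: vector_scaleR_component) (simp add: power2_eq_square)
    with lt have "e * Re (x $ 1) > e * (e * S x)"
      unfolding cmp by (simp add: S_def power_mult_distrib power2_eq_square algebra_simps del: vector_scaleR_component)
    then show ?thesis using e by (simp add: less_imp_le)
  qed
  show ?thesis
  proof
    fix x assume x: "x \<in> \<Omega>"
    show "Re (x $ 1) \<ge> \<theta> * ((cmod (x $ 2))\<^sup>2 / 2 + Re (\<beta> * (x $ 2)\<^sup>2) -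
         C * cmod (x $ 1) * (cmod (x $ 1) + cmod (x $ 2)))"
      using main[OF x \<theta>(1)] by (simp add: S_def)
    show "0 \<le> Re (x $ 1)"
    proof (rule tendsto_upperbound)
      show "((\<lambda>e. e * S x) \<longlongrightarrow> 0) (at_right 0)" by (auto intro!: tendsto_eq_intros)
      show "\<forall>\<^sub>F e in at_right 0. e * S x \<le> Re (x $ 1)"
        using main[OF x] \<theta>(1) by (auto simp: eventually_at_right_field intro!: exI[of _ \<theta>])
    qed simp
  qed (use \<theta> in auto)
qed

text \<open>On the preimage of a smaller bidisk the coordinates have size \<open>t\<close> and \<open>\<surd>t\<close>: first \<open>x\<^sub>1\<close> takes
  values in a half plane, then \<open>x\<^sub>1 - \<theta> \<beta> x\<^sub>2\<^sup>2\<close> does so up to \<open>O(t)\<close>, with real part controlling \<open>\<bar>x\<^sub>2\<bar>\<^sup>2\<close>.\<close>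

lemma localization:
  obtains K where "1 \<le> K"
    "\<And>f t x. injective_holomorphic f \<Omega> (98/100) \<Longrightarrow> 0 < t \<Longrightarrow> siegel_base t \<in> \<Omega> \<Longrightarrow> f (siegel_base t) = 0 \<Longrightarrow>
       x \<in> \<Omega> \<Longrightarrow> sup_norm2 (f x) < 9/10 \<Longrightarrow> cmod (x $ 1) \<le> 65 * t \<and> (cmod (x $ 2))\<^sup>2 \<le> K * t"
proof -
  obtain \<theta> where \<theta>: "0 < \<theta>" "\<theta> \<le> 1"
    and re: "\<And>x. x \<in> \<Omega> \<Longrightarrow> 0 \<le> Re (x $ 1)"
    and gl: "\<And>x. x \<in> \<Omega> \<Longrightarrow> Re (x $ 1) \<ge> \<theta> * ((cmod (x $ 2))\<^sup>2 / 2 + Re (\<beta> * (x $ 2)\<^sup>2) -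
         C * cmod (x $ 1) * (cmod (x $ 1) + cmod (x $ 2)))"
    using global_bound by blast
  obtain R where R: "0 < R" "\<And>x. x \<in> \<Omega> \<Longrightarrow> norm x \<le> R"
    using bounded_\<Omega> unfolding bounded_pos by blast
  \<comment> \<open>From \<open>cmod (x $ 1) \<le> 65 * t\<close> and coordinate sum at most
    \<open>2 * R\<close>, the contact error is at most \<open>K1 * t\<close>.\<close>
  define K1 where "K1 = 130 * C * R"
  have K1: "0 \<le> K1" using C_nonneg R by (simp add: K1_def)
  define K where "K = 74 * (1 + K1) / \<theta>"
  show ?thesis
  proof
    show "1 \<le> K" using \<theta> K1 by (simp add: K_def field_simps)
    fix f t x
    assume f: "injective_holomorphic f \<Omega> (98/100)" and t: "0 < t" and z: "siegel_base t \<in> \<Omega>" "f (siegel_base t) = 0"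
      and x: "x \<in> \<Omega>" "sup_norm2 (f x) < 9/10"
    interpret f98: injective_holomorphic f \<Omega> "98/100" by (rule f)
    interpret f95: injective_holomorphic f \<Omega> "95/100" by (rule f98.smaller_polydisk) auto
    \<comment> \<open>Harnack's quotient for these radii is 193/3, below 65.\<close>
    have a: "cmod (y $ 1) \<le> 65 * t" if y: "y \<in> \<Omega>" "sup_norm2 (f y) \<le> 95/100" for y
    proof -
      have "cmod (y $ 1) * (98/100 - 95/100) \<le> t * (98/100 + 95/100)"
        by (rule f98.Harnack_inverse[where u = "\<lambda>x. x $ 1" and z = "siegel_base t"]) (use y z t re in auto)
      then show ?thesis using t by simp
    qed
    define \<tau> where "\<tau> = t + \<theta> * K1 * t"
    have \<tau>: "0 < \<tau>" "\<tau> \<le> (1 + K1) * t"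
    proof -
      have "0 \<le> \<theta> * K1 * t" using t K1 \<theta> by simp
      then show "0 < \<tau>" using t by (simp add: \<tau>_def)
      have "\<theta> * (K1 * t) \<le> 1 * (K1 * t)" using \<theta> K1 t by (intro mult_right_mono) auto
      then show "\<tau> \<le> (1 + K1) * t" by (simp add: \<tau>_def algebra_simps)
    qed
    \<comment> \<open>The added constant compensates the contact error, so that the real part
      dominates a multiple of \<open>(cmod (y $ 2))\<^sup>2\<close>; at the base point
      \<open>u\<close> equals \<open>\<tau>\<close>.\<close>
    define u where "u y = y $ 1 - of_real \<theta> * \<beta> * (y $ 2 * y $ 2) + of_real (\<theta> * K1 * t)" for y :: "complex ^ 2"
    have Re_u: "\<theta> * (cmod (y $ 2))\<^sup>2 / 2 \<le> Re (u y)" if y: "y \<in> \<Omega>" "sup_norm2 (f y) \<le> 95/100" for y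
    proof -
      have "cmod (y $ 1) + cmod (y $ 2) \<le> 2 * R"
        using Finite_Cartesian_Product.norm_nth_le[of y 1] Finite_Cartesian_Product.norm_nth_le[of y 2] R(2)[OF y(1)] by simp
      then have "cmod (y $ 1) * (cmod (y $ 1) + cmod (y $ 2)) \<le> 65 * t * (2 * R)"
        using a[OF y] t by (intro mult_mono) auto
      then have "C * (cmod (y $ 1) * (cmod (y $ 1) + cmod (y $ 2))) \<le> C * (65 * t * (2 * R))"
        using C_nonneg by (rule mult_left_mono)
      then have "\<theta> * (C * cmod (y $ 1) * (cmod (y $ 1) + cmod (y $ 2))) \<le> \<theta> * (K1 * t)"
        using \<theta> by (intro mult_left_mono) (auto simp: K1_def mult_ac)
      moreover have "Re (u y) = Re (y $ 1) - \<theta> * Re (\<beta> * (y $ 2)\<^sup>2) + \<theta> * (K1 * t)"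
        by (simp add: u_def mult.assoc power2_eq_square)
      ultimately show ?thesis using gl[OF y(1)] by (simp add: algebra_simps)
    qed
    \<comment> \<open>Here the quotient is 185/5 = 37; the factor 2 from \<open>Re_u\<close> turns
      it into the 74 in \<open>K\<close>.\<close>
    have "cmod (u x) * (95/100 - 9/10) \<le> \<tau> * (95/100 + 9/10)"
    proof (rule f95.Harnack_inverse[where z = "siegel_base t"])
      show "holomorphic_fun_on u {x \<in> \<Omega>. f x \<in> polydisk (95 / 100)}"
        unfolding u_def
        by (intro holomorphic_fun_on_add holomorphic_fun_on_diff holomorphic_fun_on_mult holomorphic_fun_on_nth holomorphic_fun_on_const)
      show "0 \<le> Re (u y)" if "y \<in> \<Omega>" "f y \<in> polydisk (95/100)" for y
      proof -
        have "0 \<le> \<theta> * (cmod (y $ 2))\<^sup>2 / 2" using \<theta> by simp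
        also have "\<dots> \<le> Re (u y)" using that by (intro Re_u) (auto simp: polydisk_iff_sup_norm2)
        finally show ?thesis .
      qed
    qed (use x z \<tau> in \<open>auto simp: u_def \<tau>_def\<close>)
    then have "cmod (u x) \<le> 37 * ((1 + K1) * t)" using \<tau> by simp
    moreover have "\<theta> * (cmod (x $ 2))\<^sup>2 / 2 \<le> cmod (u x)"
      using Re_u[of x] x complex_Re_le_cmod[of "u x"] by simp
    ultimately have "\<theta> * (cmod (x $ 2))\<^sup>2 \<le> 74 * ((1 + K1) * t)" by linarith
    then have "(cmod (x $ 2))\<^sup>2 \<le> K * t" using \<theta>(1) by (simp add: K_def field_simps)
    moreover have "cmod (x $ 1) \<le> 65 * t" using x by (intro a) auto
    ultimately show "cmod (x $ 1) \<le> 65 * t \<and> (cmod (x $ 2))\<^sup>2 \<le> K * t" by simp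
  qed
qed

end

section \<open>Lower bound for the derivative at the base point\<close>

lemma tendsto_difference_quotient_along_line:
  fixes u :: "complex ^ 'n \<Rightarrow> complex"
  assumes "(u has_derivative L) (at z)" "\<And>a v. L (a *s v) = a * L v" "u z = 0"
  shows "((\<lambda>l. u (z + l *s v) / l) \<longlongrightarrow> L v) (at 0)"
proof -
  have "((\<lambda>l. u (z + l *s v)) has_field_derivative L v) (at 0)"
    by (rule has_field_derivative_along_curve[OF _ assms(2) has_derivative_affine_line]) (simp add: assms(1))
  then show ?thesis using assms(3) by (simp add: DERIV_def)
qed

context convex_siegel_contact
begin

lemma eventually_small:
  fixes \<phi> :: "real \<Rightarrow> real"
  assumes "0 < c" "continuous_on UNIV \<phi>" "\<phi> 0 = 0"
  shows "\<forall>\<^sub>F t in at_right 0. \<phi> t < c"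
proof (rule order_tendstoD(2)[OF _ assms(1)])
  have "isCont \<phi> 0" using assms(2) by (simp add: continuous_on_eq_continuous_at)
  then show "(\<phi> \<longlongrightarrow> 0) (at_right 0)"
    using assms(3) by (metis isCont_def filterlim_at_split)
qed

text \<open>The quantifier over \<open>f\<close> stands inside \<open>eventually\<close> because the
  competing map changes with \<open>t\<close>; the constant \<open>K\<close> of
  \<open>localization\<close> makes this possible. For each \<open>v\<close>, a functional of the
  Cayley coordinates with derivative \<open>siegel_norm t v\<close> along \<open>v\<close> is fed
  into the Schwarz lemma.\<close>

lemma eventually_lower_bound:
  "\<forall>\<^sub>F t in at_right 0. \<forall>f v. injective_holomorphic f \<Omega> (98/100) \<longrightarrow> f (siegel_base t) = 0 \<longrightarrow>
     siegel_norm t v \<le> 11 / 9 * sup_norm2 (frechet_derivative f (at (siegel_base t)) v)"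
proof -
  obtain K where K: "1 \<le> K"
    and loc: "\<And>f t x. injective_holomorphic f \<Omega> (98/100) \<Longrightarrow> 0 < t \<Longrightarrow> siegel_base t \<in> \<Omega> \<Longrightarrow> f (siegel_base t) = 0 \<Longrightarrow>
       x \<in> \<Omega> \<Longrightarrow> sup_norm2 (f x) < 9/10 \<Longrightarrow> cmod (x $ 1) \<le> 65 * t \<and> (cmod (x $ 2))\<^sup>2 \<le> K * t"
    using localization by blast
  \<comment> \<open>By localization the quadratic error is at most \<open>t / 200\<close>; the other
    error is made as small, and together they fill the slack \<open>t / 100\<close> of
    \<open>Cayley_functional_bound\<close>.\<close>
  define \<eta> where "\<eta> = 1 / (200 * K)"
  have \<eta>: "0 < \<eta>" using K by (simp add: \<eta>_def)
  obtain d where d: "0 < d"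
    "\<And>x. cmod (x $ 1) < d \<Longrightarrow> cmod (x $ 2) < d \<Longrightarrow> x \<in> \<Omega> \<Longrightarrow>
       Re (x $ 1) > (cmod (x $ 2))\<^sup>2 + Re (\<beta> * (x $ 2)\<^sup>2) -
         (C * cmod (x $ 1) * (cmod (x $ 1) + cmod (x $ 2)) + \<eta> * (cmod (x $ 2))\<^sup>2)"
    using contactE[OF \<eta>] by metis
  have "\<forall>\<^sub>F t in at_right 0. 65 * t < d"
    by (rule eventually_small) (auto intro!: continuous_intros d)
  moreover have "\<forall>\<^sub>F t in at_right 0. sqrt (K * t) < d"
    by (rule eventually_small) (auto intro!: continuous_intros d)
  moreover have "\<forall>\<^sub>F t in at_right 0. C * 65 * (65 * t + sqrt (K * t)) < 1 / 200"
    by (rule eventually_small) (auto intro!: continuous_intros)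
  moreover have "\<forall>\<^sub>F t::real in at_right 0. 0 < t" by (simp add: eventually_at_right_less)
  ultimately show ?thesis using eventually_base_in
  proof eventually_elim
    case (elim t)
    show ?case
    proof (intro allI impI)
      fix f v assume f: "injective_holomorphic f \<Omega> (98/100)" and f0: "f (siegel_base t) = 0"
      interpret f98: injective_holomorphic f \<Omega> "98/100" by (rule f)
      interpret f90: injective_holomorphic f \<Omega> "9/10" by (rule f98.smaller_polydisk) auto
      define H where "H = siegel_norm t v"
      have t: "0 < t" using elim by simp
      show "siegel_norm t v \<le> 11 / 9 * sup_norm2 (frechet_derivative f (at (siegel_base t)) v)"
      proof (cases "H = 0")
        case True then show ?thesis by (simp add: H_def)
      next
        case False
        then have H: "0 < H" using siegel_norm_nonneg[of t v] by (simp add: H_def less_le)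
        define p where "p = v $ 1 / (2 * of_real t)"
        define r where "r = v $ 2 / of_real (sqrt t)"
        have H2: "H\<^sup>2 = (cmod p)\<^sup>2 + (cmod r)\<^sup>2"
          unfolding H_def siegel_norm_def p_def r_def by (rule real_sqrt_pow2) simp
        \<comment> \<open>The case of equality in Cauchy-Schwarz: a unit functional with value
          \<open>H\<close> at \<open>(p, r)\<close>, the image of \<open>v\<close> under the
          derivative of the Cayley map.\<close>
        define A where "A = cnj p / of_real H"
        define B where "B = cnj r / of_real H"
        have AB: "(cmod A)\<^sup>2 + (cmod B)\<^sup>2 \<le> 1"
        proof -
          have "(cmod A)\<^sup>2 + (cmod B)\<^sup>2 = ((cmod p)\<^sup>2 + (cmod r)\<^sup>2) / H\<^sup>2"
            using H by (simp add: A_def B_def norm_divide power_divide add_divide_distrib)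
          also have "\<dots> = 1" using H by (simp flip: H2)
          finally show ?thesis by simp
        qed
        have ABH: "A * p + B * r = of_real H"
        proof -
          have "A * p + B * r = (cnj p * p + cnj r * r) / of_real H"
            by (simp add: A_def B_def add_divide_distrib)
          also have "cnj p * p + cnj r * r = of_real (H\<^sup>2)"
            by (simp only: H2 of_real_add complex_norm_square) (simp add: mult.commute)
          also have "of_real (H\<^sup>2) / of_real H = (of_real H :: complex)" using H by (simp add: power2_eq_square)
          finally show ?thesis .
        qed
        \<comment> \<open>The shear removes the harmonic term
          \<open>Re (\<beta> * (x $ 2)\<^sup>2)\<close> and has identity derivative at the base
          point.\<close>
        define w where "w x = x $ 1 - \<beta> * (x $ 2 * x $ 2)" for x :: "complex ^ 2"
        define h where "h x = (A * (w x - of_real t) + 2 * B * of_real (sqrt t) * x $ 2) / (w x + of_real t)" for x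
        have w_bound: "(cmod (x $ 2))\<^sup>2 - t / 100 \<le> Re (w x)" if x: "x \<in> \<Omega>" "f x \<in> polydisk (9/10)" for x
        proof -
          have l: "cmod (x $ 1) \<le> 65 * t" "(cmod (x $ 2))\<^sup>2 \<le> K * t"
            using loc[OF f t _ f0 x(1)] x elim by (auto simp: polydisk_iff_sup_norm2)
          then have l2: "cmod (x $ 2) \<le> sqrt (K * t)" by (simp add: real_le_rsqrt)
          have "C * cmod (x $ 1) * (cmod (x $ 1) + cmod (x $ 2)) \<le> C * (65 * t) * (65 * t + sqrt (K * t))"
            using l l2 C_nonneg t by (intro mult_mono mult_left_mono add_mono) auto
          also have "\<dots> = t * (C * 65 * (65 * t + sqrt (K * t)))" by (simp add: mult_ac)
          also have "\<dots> \<le> t * (1 / 200)" using elim t by (intro mult_left_mono) auto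
          finally have 1: "C * cmod (x $ 1) * (cmod (x $ 1) + cmod (x $ 2)) \<le> t / 200" by simp
          have "\<eta> * (cmod (x $ 2))\<^sup>2 \<le> \<eta> * (K * t)" using l \<eta> by (intro mult_left_mono) auto
          also have "\<dots> = t / 200" using K by (simp add: \<eta>_def)
          finally have 2: "\<eta> * (cmod (x $ 2))\<^sup>2 \<le> t / 200" .
          have "Re (w x) = Re (x $ 1) - Re (\<beta> * (x $ 2)\<^sup>2)" by (simp add: w_def power2_eq_square)
          moreover have "Re (x $ 1) > (cmod (x $ 2))\<^sup>2 + Re (\<beta> * (x $ 2)\<^sup>2) -
              (C * cmod (x $ 1) * (cmod (x $ 1) + cmod (x $ 2)) + \<eta> * (cmod (x $ 2))\<^sup>2)"
            using l l2 elim x by (intro d(2)) auto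
          ultimately show ?thesis using 1 2 by linarith
        qed
        have nz: "w x + of_real t \<noteq> 0" if x: "x \<in> \<Omega>" "f x \<in> polydisk (9/10)" for x
        proof
          assume "w x + of_real t = 0"
          then have "Re (w x) = - t" by (auto simp: complex_eq_iff)
          then show False using w_bound[OF x] t zero_le_power2[of "cmod (x $ 2)"] by linarith
        qed
        have hol_h: "holomorphic_fun_on h {x \<in> \<Omega>. f x \<in> polydisk (9/10)}"
          unfolding h_def
          by (intro holomorphic_fun_on_divide holomorphic_fun_on_add holomorphic_fun_on_diff holomorphic_fun_on_mult
               holomorphic_fun_on_const holomorphic_fun_on_nth nz | simp add: w_def | auto)+
        have h_le: "cmod (h x) \<le> 11 / 9 * sup_norm2 (f x)" if x: "x \<in> \<Omega>" "f x \<in> polydisk (9/10)" for x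
        proof -
          have "cmod (h x) \<le> (11 / 10) / (9 / 10) * sup_norm2 (f x)"
          proof (rule f90.Schwarz_inverse[OF hol_h])
            show "cmod (h y) \<le> 11 / 10" if "y \<in> \<Omega>" "f y \<in> polydisk (9/10)" for y
              unfolding h_def by (rule Cayley_functional_bound[OF t w_bound[OF that] AB])
            show "h (siegel_base t) = 0" by (simp add: h_def w_def)
          qed (use elim f0 x in auto)
          then show ?thesis by simp
        qed
        define z where "z = siegel_base t"
        define L where "L = frechet_derivative f (at z)"
        have z: "z \<in> \<Omega>" "f z = 0" using elim f0 by (simp_all add: z_def)
        note Df = holomorphic_map_on_frechet[OF f98.hol z(1)]
        have quot: "((\<lambda>l. f (z + l *s v) $ i / l) \<longlongrightarrow> L v $ i) (at 0)" for i
        proof -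
          note Di = holomorphic_fun_on_frechet[OF holomorphic_map_on_nth[OF f98.hol] z(1), of i]
          show ?thesis
            using tendsto_difference_quotient_along_line[OF Di(1) Di(2), of v] z(2)
            by (simp add: L_def Df(3))
        qed
        \<comment> \<open>The quotient is computed in closed form, so its limit at 0 can be read
          off.\<close>
        have hz: "h (z + l *s v) / l = (A * (v $ 1 - \<beta> * (l * (v $ 2 * v $ 2))) + 2 * B * of_real (sqrt t) * v $ 2)
            / (2 * of_real t + l * (v $ 1 - \<beta> * (l * (v $ 2 * v $ 2))))" if "l \<noteq> 0" for l
        proof -
          have "w (z + l *s v) = of_real t + l * (v $ 1 - \<beta> * (l * (v $ 2 * v $ 2)))"
            by (simp add: w_def z_def algebra_simps)
          note wl = this
          have "(z + l *s v) $ 2 = l * v $ 2" by (simp add: z_def)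
          then have "h (z + l *s v) = l * (A * (v $ 1 - \<beta> * (l * (v $ 2 * v $ 2))) + 2 * B * of_real (sqrt t) * v $ 2)
              / (2 * of_real t + l * (v $ 1 - \<beta> * (l * (v $ 2 * v $ 2))))"
            unfolding h_def wl by (simp add: algebra_simps)
          then show ?thesis using that by simp
        qed
        have "((\<lambda>l. (A * (v $ 1 - \<beta> * (l * (v $ 2 * v $ 2))) + 2 * B * of_real (sqrt t) * v $ 2)
            / (2 * of_real t + l * (v $ 1 - \<beta> * (l * (v $ 2 * v $ 2))))) \<longlongrightarrow>
            (A * (v $ 1 - \<beta> * (0 * (v $ 2 * v $ 2))) + 2 * B * of_real (sqrt t) * v $ 2)
            / (2 * of_real t + 0 * (v $ 1 - \<beta> * (0 * (v $ 2 * v $ 2))))) (at 0)"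
          using t by (intro tendsto_intros) auto
        also have "(A * (v $ 1 - \<beta> * (0 * (v $ 2 * v $ 2))) + 2 * B * of_real (sqrt t) * v $ 2)
            / (2 * of_real t + 0 * (v $ 1 - \<beta> * (0 * (v $ 2 * v $ 2)))) = A * p + B * r"
        proof -
          have "complex_of_real t = of_real (sqrt t) * of_real (sqrt t)"
            using t by (simp flip: of_real_mult)
          then have "2 * B * of_real (sqrt t) * v $ 2 / (2 * of_real t) = B * r"
            using t by (simp add: r_def)
          then show ?thesis by (simp add: p_def add_divide_distrib)
        qed
        finally have lim: "((\<lambda>l. h (z + l *s v) / l) \<longlongrightarrow> of_real H) (at 0)"
          unfolding ABH by (rule Lim_transform_eventually) (auto simp: hz eventually_at intro!: exI[of _ 1])
        \<comment> \<open>The Schwarz bound along the line, divided by \<open>cmod l\<close>, passes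
          to the limit on both sides.\<close>
        have "cmod (of_real H) \<le> 11 / 9 * max (cmod (L v $ 1)) (cmod (L v $ 2))"
        proof (rule tendsto_le)
          show "((\<lambda>l. cmod (h (z + l *s v) / l)) \<longlongrightarrow> cmod (of_real H)) (at 0)"
            by (intro tendsto_norm lim)
          show "((\<lambda>l. 11 / 9 * max (cmod (f (z + l *s v) $ 1 / l)) (cmod (f (z + l *s v) $ 2 / l)))
              \<longlongrightarrow> 11 / 9 * max (cmod (L v $ 1)) (cmod (L v $ 2))) (at 0)"
            by (intro tendsto_intros quot)
          have "((\<lambda>l. z + l *s v) \<longlongrightarrow> z + 0 *s v) (at 0)"
            by (intro tendsto_intros)
          then have lz: "((\<lambda>l. z + l *s v) \<longlongrightarrow> z) (at 0)" by simp
          have "open {x \<in> \<Omega>. f x \<in> polydisk (9/10)}"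
            using continuous_open_preimage[OF holomorphic_map_on_imp_continuous_on[OF f98.hol] f98.open_\<Omega> open_polydisk2]
            by (simp add: vimage_def Int_def)
          moreover have "z \<in> {x \<in> \<Omega>. f x \<in> polydisk (9/10)}" using z by (simp add: polydisk_def)
          ultimately have "\<forall>\<^sub>F l in at 0. z + l *s v \<in> {x \<in> \<Omega>. f x \<in> polydisk (9/10)}"
            using lz topological_tendstoD by blast
          then show "\<forall>\<^sub>F l in at 0. cmod (h (z + l *s v) / l)
              \<le> 11 / 9 * max (cmod (f (z + l *s v) $ 1 / l)) (cmod (f (z + l *s v) $ 2 / l))"
          proof eventually_elim
            case (elim l)
            then have "cmod (h (z + l *s v)) / cmod l \<le> 11 / 9 * sup_norm2 (f (z + l *s v)) / cmod l"
              by (intro divide_right_mono h_le) auto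
            also have "\<dots> = 11 / 9 * max (cmod (f (z + l *s v) $ 1 / l)) (cmod (f (z + l *s v) $ 2 / l))"
              unfolding sup_norm2_def norm_divide times_divide_eq_right[symmetric]
              by (simp add: max_divide_distrib_right)
            finally show ?case by (simp add: norm_divide)
          qed
        qed simp
        then show ?thesis using H by (simp add: H_def[symmetric] L_def z_def sup_norm2_def)
      qed
    qed
  qed
qed

end

section \<open>Upper bound for the derivative by disks in the ball of radius 9/10\<close>

lemma ball_to_siegel_estimates:
  assumes t: "0 < t" and ball: "(cmod \<xi>)\<^sup>2 + (cmod \<eta>)\<^sup>2 \<le> 81 / 100"
  defines "w \<equiv> of_real t * ((1 + \<xi>) / (1 - \<xi>))" and "b \<equiv> of_real (sqrt t) * (\<eta> / (1 - \<xi>))"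
  shows "\<xi> \<noteq> 1" "cmod w \<le> 19 * t" "cmod b \<le> 9 * sqrt t" "(cmod b)\<^sup>2 + t / 20 \<le> Re w"
proof -
  have \<xi>: "cmod \<xi> \<le> 9 / 10" and \<eta>: "cmod \<eta> \<le> 9 / 10"
  proof -
    have "(cmod \<xi>)\<^sup>2 \<le> (9 / 10)\<^sup>2" "(cmod \<eta>)\<^sup>2 \<le> (9 / 10)\<^sup>2"
      using ball zero_le_power2[of "cmod \<xi>"] zero_le_power2[of "cmod \<eta>"]
      unfolding power2_eq_square by linarith+
    then show "cmod \<xi> \<le> 9 / 10" "cmod \<eta> \<le> 9 / 10"
      by - (rule power2_le_imp_le, simp_all)+
  qed
  define N where "N = cmod (1 - \<xi>)"
  \<comment> \<open>These two bounds produce the constants: \<open>19 = (19/10) / (1/10)\<close> and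
    \<open>9 = (9/10) / (1/10)\<close>.\<close>
  have N: "1 / 10 \<le> N" "N \<le> 19 / 10"
    using norm_triangle_ineq2[of 1 \<xi>] norm_triangle_ineq4[of 1 \<xi>] \<xi> by (simp_all add: N_def)
  show "\<xi> \<noteq> 1" using \<xi> by auto
  have "cmod (1 + \<xi>) \<le> 19 / 10" using norm_triangle_ineq[of 1 \<xi>] \<xi> by simp
  then have "cmod (1 + \<xi>) / N \<le> (19 / 10) / (1 / 10)" using N by (intro frac_le) auto
  then have "t * (cmod (1 + \<xi>) / N) \<le> t * 19" using t by (intro mult_left_mono) auto
  then show "cmod w \<le> 19 * t" using t by (simp add: w_def norm_mult norm_divide N_def)
  have "cmod \<eta> / N \<le> (9 / 10) / (1 / 10)" using N \<eta> by (intro frac_le) auto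
  then have "sqrt t * (cmod \<eta> / N) \<le> sqrt t * 9" using t by (intro mult_left_mono) auto
  then show "cmod b \<le> 9 * sqrt t" using t by (simp add: b_def norm_mult norm_divide N_def)
  have Re: "Re ((1 + \<xi>) / (1 - \<xi>)) = (1 - (cmod \<xi>)\<^sup>2) / N\<^sup>2"
    unfolding N_def Re_divide' cmod_power2 by (simp add: power2_eq_square algebra_simps)
  have b2: "(cmod b)\<^sup>2 = t * ((cmod \<eta>)\<^sup>2 / N\<^sup>2)"
    using t by (simp add: b_def norm_mult norm_divide N_def power_mult_distrib power_divide)
  have Re_w: "Re w = t * ((1 - (cmod \<xi>)\<^sup>2) / N\<^sup>2)"
    by (simp only: w_def times_complex.sel Re_complex_of_real Im_complex_of_real mult_zero_left diff_zero Re)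
  have "Re w - (cmod b)\<^sup>2 = t * ((1 - (cmod \<xi>)\<^sup>2 - (cmod \<eta>)\<^sup>2) / N\<^sup>2)"
    by (simp only: b2 Re_w) (simp add: diff_divide_distrib add_divide_distrib algebra_simps)
  \<comment> \<open>The numerator is at least 19/100 and \<open>N\<^sup>2\<close> at most 361/100,
    with quotient 1/19.\<close>
  moreover have "1 / 20 \<le> (1 - (cmod \<xi>)\<^sup>2 - (cmod \<eta>)\<^sup>2) / N\<^sup>2"
  proof -
    have "N\<^sup>2 \<le> (19 / 10)\<^sup>2" using N by (intro power_mono) auto
    moreover have "0 < N\<^sup>2" using N by simp
    ultimately show ?thesis using ball by (simp add: pos_le_divide_eq power2_eq_square)
  qed
  then have "t * (1 / 20) \<le> t * ((1 - (cmod \<xi>)\<^sup>2 - (cmod \<eta>)\<^sup>2) / N\<^sup>2)"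
    using t by (intro mult_left_mono) auto
  ultimately show "(cmod b)\<^sup>2 + t / 20 \<le> Re w" by linarith
qed

context convex_siegel_contact
begin

text \<open>A linear disk in direction \<open>v\<close>, of radius 9/10 in the unit ball, is carried
  into \<open>\<Omega>\<close> by the inverse Cayley map and the inverse shear. The reduced radius
  keeps it at depth of order \<open>t\<close>, where contact errors are harmless, and produces the
  factor 10/9.\<close>

lemma eventually_upper_bound:
  "\<forall>\<^sub>F t in at_right 0. \<forall>(f :: complex ^ 2 \<Rightarrow> complex ^ 2) v. holomorphic_map_on f \<Omega> \<longrightarrow> f ` \<Omega> \<subseteq> polydisk 1 \<longrightarrow> f (siegel_base t) = 0 \<longrightarrow>
     sup_norm2 (frechet_derivative f (at (siegel_base t)) v) \<le> 10 / 9 * siegel_norm t v"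
proof -
  \<comment> \<open>Since \<open>(cmod b)\<^sup>2 \<le> 81 * t\<close> and
    \<open>81 / 3240 = 1 / 40\<close>, this error takes half of the margin \<open>t / 20\<close>;
    the term with \<open>C\<close> takes the other half.\<close>
  define \<delta> :: real where "\<delta> = 1 / 3240"
  obtain d where d: "0 < d"
    "\<And>x. cmod (x $ 1) < d \<Longrightarrow> cmod (x $ 2) < d \<Longrightarrow>
       Re (x $ 1) > (cmod (x $ 2))\<^sup>2 + Re (\<beta> * (x $ 2)\<^sup>2) +
         (C * cmod (x $ 1) * (cmod (x $ 1) + cmod (x $ 2)) + \<delta> * (cmod (x $ 2))\<^sup>2) \<Longrightarrow> x \<in> \<Omega>"
    using contactE[of \<delta>] unfolding \<delta>_def by (metis zero_less_divide_1_iff zero_less_numeral)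
  \<comment> \<open>Bounds \<open>cmod w + cmod \<beta> * (cmod b)\<^sup>2\<close> in units of
    \<open>t\<close>.\<close>
  define K where "K = 19 + 81 * cmod \<beta>"
  have K: "0 \<le> K" by (simp add: K_def)
  have "\<forall>\<^sub>F t in at_right 0. K * t < d"
    by (rule eventually_small) (auto intro!: continuous_intros d)
  moreover have "\<forall>\<^sub>F t in at_right 0. 9 * sqrt t < d"
    by (rule eventually_small) (auto intro!: continuous_intros d)
  moreover have "\<forall>\<^sub>F t in at_right 0. C * K * (K * t + 9 * sqrt t) < 1 / 40"
    by (rule eventually_small) (auto intro!: continuous_intros)
  moreover have "\<forall>\<^sub>F t::real in at_right 0. 0 < t" by (simp add: eventually_at_right_less)
  ultimately show ?thesis using eventually_base_in
  proof eventually_elim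
    case (elim t)
    show ?case
    proof (intro allI impI)
      fix f :: "complex ^ 2 \<Rightarrow> complex ^ 2" and v
      assume f: "holomorphic_map_on f \<Omega>" "f ` \<Omega> \<subseteq> polydisk 1" and f0: "f (siegel_base t) = 0"
      define H where "H = siegel_norm t v"
      have t: "0 < t" using elim by simp
      note Df = holomorphic_map_on_frechet[OF f(1) \<open>siegel_base t \<in> \<Omega>\<close>]
      show "sup_norm2 (frechet_derivative f (at (siegel_base t)) v) \<le> 10 / 9 * siegel_norm t v"
      proof (cases "H = 0")
        case True
        then have "v = 0" using siegel_norm_eq_0[OF t] by (simp add: H_def)
        then have "frechet_derivative f (at (siegel_base t)) v = 0"
          using linear_0[OF has_derivative_linear[OF Df(1)]] by simp
        then show ?thesis using siegel_norm_nonneg[of t v] by (simp add: sup_norm2_def)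
      next
        case False
        then have H: "0 < H" using siegel_norm_nonneg[of t v] by (simp add: H_def less_le)
        define A where "A = 9 / 10 * (v $ 1 / (2 * of_real t)) / of_real H"
        define B where "B = 9 / 10 * (v $ 2 / of_real (sqrt t)) / of_real H"
        have AB: "(cmod A)\<^sup>2 + (cmod B)\<^sup>2 = 81 / 100"
        proof -
          have "H\<^sup>2 = (cmod (v $ 1 / (2 * of_real t)))\<^sup>2 + (cmod (v $ 2 / of_real (sqrt t)))\<^sup>2"
            unfolding H_def siegel_norm_def by (rule real_sqrt_pow2) simp
          moreover have "(cmod A)\<^sup>2 = 81 / 100 * (cmod (v $ 1 / (2 * of_real t)))\<^sup>2 / H\<^sup>2"
            "(cmod B)\<^sup>2 = 81 / 100 * (cmod (v $ 2 / of_real (sqrt t)))\<^sup>2 / H\<^sup>2"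
            unfolding A_def B_def norm_divide[of _ "of_real H"] norm_mult[of "9/10"] power_divide[of _ "cmod (of_real H)"] power_mult_distrib
            using H by (simp_all add: norm_divide power_divide)
          ultimately have "(cmod A)\<^sup>2 + (cmod B)\<^sup>2 = 81 / 100 * H\<^sup>2 / H\<^sup>2"
            by (simp add: add_divide_distrib distrib_left)
          then show ?thesis using H by simp
        qed
        define b where "b l = of_real (sqrt t) * (B * l / (1 - A * l))" for l
        define w where "w l = of_real t * ((1 + A * l) / (1 - A * l))" for l
        \<comment> \<open>The inverse of the shear.\<close>
        define a where "a l = w l + \<beta> * (b l * b l)" for l
        define c where "c l = a l *s axis 1 1 + b l *s (axis 2 1 :: complex ^ 2)" for l :: complex
        have c_nth: "c l $ 1 = a l" "c l $ 2 = b l" for l by (simp_all add: c_def axis_def)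
        have est: "A * l \<noteq> 1" "cmod (w l) \<le> 19 * t" "cmod (b l) \<le> 9 * sqrt t" "(cmod (b l))\<^sup>2 + t / 20 \<le> Re (w l)"
          if l: "cmod l < 1" for l
        proof -
          have "(cmod (A * l))\<^sup>2 + (cmod (B * l))\<^sup>2 = (81 / 100) * (cmod l)\<^sup>2"
            by (simp add: norm_mult power_mult_distrib AB[symmetric] algebra_simps)
          also have "\<dots> \<le> 81 / 100" using l by (simp add: power_le_one)
          finally have "(cmod (A * l))\<^sup>2 + (cmod (B * l))\<^sup>2 \<le> 81 / 100" .
          from ball_to_siegel_estimates[OF t this]
          show "A * l \<noteq> 1" "cmod (w l) \<le> 19 * t" "cmod (b l) \<le> 9 * sqrt t" "(cmod (b l))\<^sup>2 + t / 20 \<le> Re (w l)"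
            by (simp_all add: w_def b_def)
        qed
        have c_in: "c l \<in> \<Omega>" if l: "cmod l < 1" for l
        proof (rule d(2))
          note e = est[OF l]
          have b2: "(cmod (b l))\<^sup>2 \<le> 81 * t"
            using power_mono[OF e(3), of 2] t by (simp add: power_mult_distrib)
          have al: "cmod (a l) \<le> K * t"
          proof -
            have "cmod (a l) \<le> cmod (w l) + cmod \<beta> * (cmod (b l))\<^sup>2"
              unfolding a_def using norm_triangle_ineq[of "w l" "\<beta> * (b l * b l)"]
              by (simp add: norm_mult power2_eq_square)
            also have "\<dots> \<le> 19 * t + cmod \<beta> * (81 * t)"
              using e b2 by (intro add_mono mult_left_mono) auto
            finally show ?thesis by (simp add: K_def algebra_simps)
          qed
          show "cmod (c l $ 1) < d" "cmod (c l $ 2) < d" using al e elim by (auto simp: c_nth)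
          have "C * cmod (a l) * (cmod (a l) + cmod (b l)) \<le> C * (K * t) * (K * t + 9 * sqrt t)"
            using al e C_nonneg K t by (intro mult_mono mult_left_mono add_mono) auto
          also have "\<dots> = t * (C * K * (K * t + 9 * sqrt t))" by (simp add: mult_ac)
          also have "\<dots> < t * (1 / 40)" using elim t by (intro mult_strict_left_mono) auto
          finally have 1: "C * cmod (a l) * (cmod (a l) + cmod (b l)) < t / 40" by simp
          have 2: "\<delta> * (cmod (b l))\<^sup>2 \<le> t / 40" using b2 by (simp add: \<delta>_def)
          have "Re (a l) = Re (w l) + Re (\<beta> * (b l)\<^sup>2)" by (simp add: a_def power2_eq_square)
          then show "Re (c l $ 1) > (cmod (c l $ 2))\<^sup>2 + Re (\<beta> * (c l $ 2)\<^sup>2) +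
             (C * cmod (c l $ 1) * (cmod (c l $ 1) + cmod (c l $ 2)) + \<delta> * (cmod (c l $ 2))\<^sup>2)"
            unfolding c_nth using 1 2 e(4) by linarith
        qed
        have der_c: "\<exists>D. (c has_derivative (\<lambda>h. h *s D)) (at l)" if l: "cmod l < 1" for l
        proof -
          have nz: "1 - A * l \<noteq> 0" using est(1)[OF l] by simp
          have "b field_differentiable at l" "w field_differentiable at l"
            unfolding b_def w_def using nz by (auto intro!: derivative_intros)
          then have "a field_differentiable at l" unfolding a_def by (intro derivative_intros)
          with \<open>b field_differentiable at l\<close> obtain a' b' where
            ab: "(a has_field_derivative a') (at l)" "(b has_field_derivative b') (at l)"
            unfolding field_differentiable_def by blast
          have "(c has_derivative (\<lambda>h. (a' * h) *s axis 1 1 + (b' * h) *s axis 2 1)) (at l)"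
            unfolding c_def using ab unfolding has_field_derivative_def by (intro derivative_intros)
          moreover have "(a' * h) *s axis 1 1 + (b' * h) *s axis 2 1 = h *s (a' *s axis 1 1 + b' *s (axis 2 1 :: complex ^ 2))" for h
            by (simp add: vec_eq_iff algebra_simps)
          ultimately have "(c has_derivative (\<lambda>h. h *s (a' *s axis 1 1 + b' *s axis 2 1))) (at l)"
            by (simp only:)
          then show ?thesis by blast
        qed
        \<comment> \<open>The derivative of the inverse Cayley map undoes the scaling in
          \<open>A\<close> and \<open>B\<close>; the square of \<open>b\<close> contributes nothing
          because \<open>b 0 = 0\<close>.\<close>
        have der_c0: "(c has_derivative (\<lambda>h. h *s (of_real (9 / 10 / H) *s v))) (at 0)"
        proof -
          have b0: "(b has_field_derivative of_real (sqrt t) * B) (at 0)"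
            unfolding b_def by (auto intro!: derivative_eq_intros)
          have w0: "(w has_field_derivative of_real t * (2 * A)) (at 0)"
            unfolding w_def by (auto intro!: derivative_eq_intros)
          have a0: "(a has_field_derivative of_real t * (2 * A)) (at 0)"
            unfolding a_def by (auto intro!: derivative_eq_intros b0 w0 simp: b_def)
          have "(c has_derivative (\<lambda>h. (of_real t * (2 * A) * h) *s axis 1 1 + (of_real (sqrt t) * B * h) *s axis 2 1)) (at 0)"
            unfolding c_def using a0 b0 unfolding has_field_derivative_def by (intro derivative_intros)
          moreover have "(of_real t * (2 * A) * h) *s axis 1 1 + (of_real (sqrt t) * B * h) *s axis 2 1
              = h *s (of_real (9 / 10 / H) *s v)" for h
            using t H by (simp add: vec_eq_iff forall_2 axis_def A_def B_def)
          ultimately show ?thesis by simp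
        qed
        have c0: "c 0 = siegel_base t"
          by (simp add: vec_eq_iff forall_2 c_nth a_def b_def w_def)
        have comp: "cmod (frechet_derivative f (at (siegel_base t)) v $ i) \<le> 10 / 9 * H" for i
        proof -
          have fi: "holomorphic_fun_on (\<lambda>x. f x $ i) \<Omega>" by (rule holomorphic_map_on_nth[OF f(1)])
          define F where "F l = f (c l) $ i" for l
          have hol: "F holomorphic_on ball 0 1"
            unfolding holomorphic_on_def
          proof (rule ballI, rule field_differentiable_at_within)
            fix l :: complex assume "l \<in> ball 0 1"
            then have l: "cmod l < 1" by simp
            obtain D where D: "(c has_derivative (\<lambda>h. h *s D)) (at l)" using der_c[OF l] by blast
            show "F field_differentiable at l"
              unfolding F_def field_differentiable_def
              using has_field_derivative_along_curve[OF holomorphic_fun_on_frechet[OF fi c_in[OF l]] D] by blast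
          qed
          have "cmod (deriv F 0) \<le> 1"
          proof (rule Schwarz_Lemma(2)[OF hol])
            show "F 0 = 0" by (simp add: F_def c0 f0)
            show "cmod (F l) < 1" if "cmod l < 1" for l
              using f(2) c_in[OF that] by (auto simp: F_def polydisk_def)
            show "cmod 0 < 1" by simp
          qed
          moreover have "deriv F 0 = of_real (9 / 10 / H) * frechet_derivative f (at (siegel_base t)) v $ i"
          proof (rule DERIV_imp_deriv)
            have b: "c 0 \<in> \<Omega>" by (rule c_in) simp
            have "(F has_field_derivative frechet_derivative (\<lambda>x. f x $ i) (at (c 0)) (of_real (9 / 10 / H) *s v)) (at 0)"
              unfolding F_def
              by (rule has_field_derivative_along_curve[OF holomorphic_fun_on_frechet[OF fi b] der_c0])
            then show "(F has_field_derivative of_real (9 / 10 / H) * frechet_derivative f (at (siegel_base t)) v $ i) (at 0)"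
              unfolding holomorphic_fun_on_frechet(2)[OF fi b] unfolding c0 Df(3) .
          qed
          ultimately show ?thesis using H by (simp add: norm_mult norm_divide field_simps)
        qed
        show ?thesis using comp[of 1] comp[of 2] by (simp add: sup_norm2_def H_def)
      qed
    qed
  qed
qed

lemma eventually_no_bidisk_like_map:
  "\<forall>\<^sub>F t in at_right 0. siegel_base t \<in> \<Omega> \<and>
     (\<forall>f. injective_holomorphic f \<Omega> (98/100) \<longrightarrow> f ` \<Omega> \<subseteq> polydisk 1 \<longrightarrow> f (siegel_base t) \<noteq> 0)"
proof -
  have "\<forall>\<^sub>F t::real in at_right 0. 0 < t" by (simp add: eventually_at_right_less)
  then show ?thesis using eventually_base_in eventually_lower_bound eventually_upper_bound
  proof eventually_elim
    case (elim t)
    have False if f: "injective_holomorphic f \<Omega> (98/100)" "f ` \<Omega> \<subseteq> polydisk 1" "f (siegel_base t) = 0" for f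
    proof -
      interpret injective_holomorphic f \<Omega> "98/100" by (rule f)
      show False
      proof (rule bidisk_norm_not_Hilbert)
        show "linear (frechet_derivative f (at (siegel_base t)))"
          using holomorphic_map_on_frechet(1)[OF hol elim(2)] by (rule has_derivative_linear)
      qed (use elim f hol in blast)+
    qed
    then show ?case using elim by blast
  qed
qed

end

text \<open>A large supremum yields an actual map only if the set is nonempty. A translation
  followed by a dilation is a member for small \<open>r\<close>.\<close>

lemma squeezing_polydisk_maps_exist:
  fixes \<Omega> :: "(complex ^ 'n) set"
  assumes "open \<Omega>" "bounded \<Omega>" "z \<in> \<Omega>"
  shows "{r. 0 < r \<and> (\<exists>f :: complex ^ 'n \<Rightarrow> complex ^ 'n.
            holomorphic_map_on f \<Omega> \<and> inj_on f \<Omega> \<and> f ` \<Omega> \<subseteq> polydisk 1 \<and>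
            f z = 0 \<and> polydisk r \<subseteq> f ` \<Omega>)} \<noteq> {}"
proof -
  obtain M where M: "0 < M" "\<And>x. x \<in> \<Omega> \<Longrightarrow> norm (x - z) < M"
  proof -
    obtain R where R: "0 < R" "\<And>x. x \<in> \<Omega> \<Longrightarrow> norm x \<le> R" using assms(2) unfolding bounded_pos by blast
    have "norm (x - z) < 2 * R + 1" if "x \<in> \<Omega>" for x
      using norm_triangle_ineq4[of x z] R(2)[OF that] R(2)[OF assms(3)] by linarith
    then show ?thesis using that[of "2 * R + 1"] R(1) by simp
  qed
  obtain e where e: "0 < e" "ball z e \<subseteq> \<Omega>" using assms open_contains_ball by blast
  \<comment> \<open>The number of coordinates compares the Euclidean norm with the largest modulus
    of a coordinate.\<close>
  define r where "r = e / (M * real CARD('n))"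
  define f where "f x = (1 / M) *\<^sub>R (x - z)" for x
  have "0 < r" using e M by (simp add: r_def)
  moreover have "holomorphic_map_on f \<Omega>"
    unfolding holomorphic_map_on_def f_def
    by (intro ballI exI[of _ "\<lambda>v. (1 / M) *\<^sub>R v"]) (auto intro!: derivative_eq_intros simp: vec_eq_iff)
  moreover have "inj_on f \<Omega>" using M by (auto simp: f_def inj_on_def)
  moreover have "f ` \<Omega> \<subseteq> polydisk 1"
  proof
    fix y assume "y \<in> f ` \<Omega>"
    then obtain x where x: "x \<in> \<Omega>" "y = f x" by blast
    have "cmod (y $ i) < 1" for i
    proof -
      have "cmod (y $ i) \<le> norm (x - z) / M"
        using Finite_Cartesian_Product.norm_nth_le[of y i] M by (simp add: x f_def)
      also have "\<dots> < 1" using M(1) M(2)[OF x(1)] by simp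
      finally show ?thesis .
    qed
    then show "y \<in> polydisk 1" by (simp add: polydisk_def)
  qed
  moreover have "f z = 0" by (simp add: f_def)
  moreover have "polydisk r \<subseteq> f ` \<Omega>"
  proof
    fix y :: "complex ^ 'n" assume y: "y \<in> polydisk r"
    have "norm y \<le> (\<Sum>i\<in>UNIV. cmod (y $ i))"
      unfolding norm_vec_def by (rule L2_set_le_sum) simp
    also have "\<dots> < (\<Sum>i\<in>(UNIV :: 'n set). r)"
      using y by (intro sum_strict_mono) (auto simp: polydisk_def)
    also have "\<dots> = e / M" by (simp add: r_def)
    finally have "norm (M *\<^sub>R y) < e" using M by (simp add: field_simps)
    then have "z + M *\<^sub>R y \<in> \<Omega>" using e(2) by (auto simp: subset_iff dist_norm)
    moreover have "f (z + M *\<^sub>R y) = y" using M by (simp add: f_def)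
    ultimately show "y \<in> f ` \<Omega>" by (metis imageI)
  qed
  ultimately show ?thesis by blast
qed

section \<open>Affine change of coordinates and conclusion\<close>

lemma injective_holomorphic_affine_pullback:
  fixes l :: "complex ^ 2 \<Rightarrow> complex ^ 2"
  assumes lin: "linear l" and cl: "\<And>a x. l (a *s x) = a *s l x" and inj_l: "inj l"
    and f: "injective_holomorphic f \<Omega> s"
  shows "injective_holomorphic (\<lambda>x. f (q + l x)) {x. q + l x \<in> \<Omega>} s"
    and "(\<lambda>x. f (q + l x)) ` {x. q + l x \<in> \<Omega>} = f ` \<Omega>"
proof -
  interpret injective_holomorphic f \<Omega> s by (rule f)
  have surj: "\<exists>x. y = q + l x" for y
    using linear_injective_imp_surjective[OF lin inj_l] by (metis add.commute diff_add_cancel surj_def)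
  show img: "(\<lambda>x. f (q + l x)) ` {x. q + l x \<in> \<Omega>} = f ` \<Omega>"
  proof (intro equalityI subsetI)
    fix w assume "w \<in> f ` \<Omega>"
    then obtain y where y: "y \<in> \<Omega>" "w = f y" by blast
    obtain x where "y = q + l x" using surj by blast
    with y show "w \<in> (\<lambda>x. f (q + l x)) ` {x. q + l x \<in> \<Omega>}" by blast
  qed blast
  show "injective_holomorphic (\<lambda>x. f (q + l x)) {x. q + l x \<in> \<Omega>} s"
  proof
    have "open ((\<lambda>x. q + l x) -` \<Omega>)"
      by (intro open_vimage open_\<Omega> continuous_intros linear_continuous_on) (use lin in \<open>simp add: linear_conv_bounded_linear\<close>)
    then show "open {x. q + l x \<in> \<Omega>}" by (simp add: vimage_def)
    show "holomorphic_map_on (\<lambda>x. f (q + l x)) {x. q + l x \<in> \<Omega>}"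
      unfolding holomorphic_map_on_def
    proof
      fix x assume "x \<in> {x. q + l x \<in> \<Omega>}"
      then have x: "q + l x \<in> \<Omega>" by simp
      note D = holomorphic_map_on_frechet[OF hol x]
      have "((\<lambda>x. f (q + l x)) has_derivative (\<lambda>h. frechet_derivative f (at (q + l x)) (l h))) (at x)"
        by (rule has_derivative_compose[where f = "\<lambda>x. q + l x", OF _ D(1)])
           (auto intro!: derivative_eq_intros linear_imp_has_derivative lin)
      then show "\<exists>L. ((\<lambda>x. f (q + l x)) has_derivative L) (at x) \<and> (\<forall>c v. L (c *s v) = c *s L v)"
        by (rule_tac exI, intro conjI allI, assumption) (simp add: cl D(2))
    qed
    show "inj_on (\<lambda>x. f (q + l x)) {x. q + l x \<in> \<Omega>}"
    proof (rule inj_onI)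
      fix x y assume "x \<in> {x. q + l x \<in> \<Omega>}" "y \<in> {x. q + l x \<in> \<Omega>}" "f (q + l x) = f (q + l y)"
      then have "q + l x = q + l y" using inj_onD[OF inj] by blast
      then show "x = y" using injD[OF inj_l] by simp
    qed
    show "polydisk s \<subseteq> (\<lambda>x. f (q + l x)) ` {x. q + l x \<in> \<Omega>}" unfolding img by (rule image)
  qed (rule s_pos)
qed

theorem corollary1p7:
  fixes \<Omega> :: "(complex ^ 2) set" and p :: "complex ^ 2"
  assumes "open \<Omega>" and "connected \<Omega>" and "\<Omega> \<noteq> {}"
    and "bounded \<Omega>" and "convex \<Omega>"
    and "p \<in> frontier \<Omega>"
    and "smooth_boundary_near \<Omega> p"
    and "(squeezing_polydisk \<Omega> \<longlongrightarrow> 1) (at p within \<Omega>)"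
  shows "\<exists>U. open U \<and> p \<in> U \<and> (\<forall>q \<in> frontier \<Omega> \<inter> U. levi_flat_at \<Omega> q)"
proof -
  obtain U0 where U0: "open U0" "p \<in> U0"
    "\<And>q. q \<in> frontier \<Omega> \<inter> U0 \<Longrightarrow> \<exists>V \<rho>. local_defining_function \<Omega> q V \<rho>"
    using assms(7) unfolding smooth_boundary_near_def by blast
  have "\<forall>\<^sub>F z in at p within \<Omega>. 98 / 100 < squeezing_polydisk \<Omega> z"
    by (rule order_tendstoD(1)[OF assms(8)]) simp
  then obtain e where e: "0 < e"
    "\<And>z. z \<in> \<Omega> \<Longrightarrow> z \<noteq> p \<Longrightarrow> dist z p < e \<Longrightarrow> 98 / 100 < squeezing_polydisk \<Omega> z"
    unfolding eventually_at by blast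
  \<comment> \<open>The limit says nothing about the point \<open>p\<close> itself, but no point of
    the open set \<open>\<Omega>\<close> equals it.\<close>
  have p: "p \<notin> \<Omega>" using assms(1,6) by (auto simp: frontier_def interior_open)
  have "levi_flat_at \<Omega> q" if q: "q \<in> frontier \<Omega> \<inter> (U0 \<inter> ball p e)" for q
  proof -
    obtain V \<rho> where \<rho>: "local_defining_function \<Omega> q V \<rho>" using U0(3) q by blast
    have "levi_form \<rho> q w = 0"
      if w: "(\<Sum>i\<in>UNIV. wirtinger_z i (\<lambda>z. complex_of_real (\<rho> z)) q * w $ i) = 0" for w
    proof (rule ccontr)
      assume "levi_form \<rho> q w \<noteq> 0"
      note form = siegel_contact_normal_form[OF assms(5) \<rho> w this]
      obtain n u \<beta> C where C: "0 \<le> C"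
        and indep: "\<forall>a b. a *s n + b *s u = 0 \<longrightarrow> a = 0 \<and> b = 0"
        and contact: "siegel_contact {x. q + (x $ 1 *s n + x $ 2 *s u) \<in> \<Omega>} \<beta> C"
        using form by blast
      define l where "l x = x $ 1 *s n + x $ 2 *s u" for x :: "complex ^ 2"
      have lin: "linear l" by (rule linearI) (simp_all add: l_def vec_eq_iff algebra_simps)
      have cl: "l (a *s x) = a *s l x" for a x by (simp add: l_def vec_eq_iff algebra_simps)
      have inj: "inj l"
        unfolding linear_injective_0[OF lin]
      proof (intro allI impI)
        fix x assume "l x = 0"
        then have "x $ 1 = 0 \<and> x $ 2 = 0"
          using indep[rule_format, of "x $ 1" "x $ 2"] by (simp only: l_def)
        then show "x = 0" by (simp add: vec_eq_iff forall_2)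
      qed
      \<comment> \<open>The inverse of \<open>l\<close> presents the pulled-back domain as part of a
        linear image of a bounded set.\<close>
      obtain k where k: "linear k" "\<And>x. k (l x) = x"
        using linear_injective_isomorphism[OF lin inj] by blast
      define \<Omega>' where "\<Omega>' = {x. q + l x \<in> \<Omega>}"
      have eq: "\<Omega>' = l -` ((\<lambda>y. y - q) ` \<Omega>)"
        by (auto simp: \<Omega>'_def image_iff) (metis add_diff_cancel_left')
      interpret convex_siegel_contact \<Omega>' \<beta> C
      proof
        have "open ((\<lambda>x. q + l x) -` \<Omega>)"
          by (intro open_vimage assms(1) continuous_intros linear_continuous_on)
             (use lin in \<open>simp add: linear_conv_bounded_linear\<close>)
        then show "open \<Omega>'" by (simp add: vimage_def \<Omega>'_def)
        show "convex \<Omega>'"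
          unfolding eq by (intro convex_linear_vimage lin convex_translation_subtract assms(5))
        have "bounded (k ` ((\<lambda>y. y - q) ` \<Omega>))"
          using k(1) by (intro bounded_linear_image bounded_translation_minus assms(4)) (simp add: linear_conv_bounded_linear)
        moreover have "\<Omega>' \<subseteq> k ` ((\<lambda>y. y - q) ` \<Omega>)"
          unfolding eq by (metis k(2) image_eqI subsetI vimageE)
        ultimately show "bounded \<Omega>'" by (rule bounded_subset)
        show "siegel_contact \<Omega>' \<beta> C" using contact by (simp add: \<Omega>'_def l_def)
      qed (rule C)
      have lb: "l (siegel_base t) = complex_of_real t *s n" for t by (simp add: l_def)
      \<comment> \<open>The base points tend to \<open>q\<close>, an interior point of the ball
        about \<open>p\<close>, so the threshold 98/100 applies at them for small
        \<open>t\<close>.\<close>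
      have "((\<lambda>t. q + complex_of_real t *s n) \<longlongrightarrow> q + complex_of_real 0 *s n) (at_right 0)"
        by (intro tendsto_intros)
      then have "\<forall>\<^sub>F t in at_right 0. q + l (siegel_base t) \<in> ball p e"
        unfolding lb using q by (intro topological_tendstoD[of _ q]) auto
      then have "\<forall>\<^sub>F t in at_right 0. q + l (siegel_base t) \<in> ball p e \<and> siegel_base t \<in> \<Omega>' \<and>
         (\<forall>f. injective_holomorphic f \<Omega>' (98/100) \<longrightarrow> f ` \<Omega>' \<subseteq> polydisk 1 \<longrightarrow> f (siegel_base t) \<noteq> 0)"
        using eventually_no_bidisk_like_map by eventually_elim auto
      then obtain t where t_all: "q + l (siegel_base t) \<in> ball p e \<and> siegel_base t \<in> \<Omega>' \<and>
         (\<forall>f. injective_holomorphic f \<Omega>' (98/100) \<longrightarrow> f ` \<Omega>' \<subseteq> polydisk 1 \<longrightarrow> f (siegel_base t) \<noteq> 0)"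
        by (rule exE[OF eventually_happens'[OF trivial_limit_at_right_real]])
      then have t: "q + l (siegel_base t) \<in> ball p e" "siegel_base t \<in> \<Omega>'"
        "\<And>f. injective_holomorphic f \<Omega>' (98/100) \<Longrightarrow> f ` \<Omega>' \<subseteq> polydisk 1 \<Longrightarrow> f (siegel_base t) \<noteq> 0"
        by simp_all
      define z where "z = q + l (siegel_base t)"
      have z: "z \<in> \<Omega>" using t(2) by (simp add: \<Omega>'_def z_def)
      then have "98 / 100 < squeezing_polydisk \<Omega> z"
        using t(1) p by (intro e(2)) (auto simp: z_def dist_commute)
      then obtain r where r_in: "r \<in> {r. 0 < r \<and> (\<exists>f :: complex ^ 2 \<Rightarrow> complex ^ 2.
            holomorphic_map_on f \<Omega> \<and> inj_on f \<Omega> \<and> f ` \<Omega> \<subseteq> polydisk 1 \<and>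
            f z = 0 \<and> polydisk r \<subseteq> f ` \<Omega>)}" and r: "98 / 100 < r"
        unfolding squeezing_polydisk_def
        by (rule less_cSupE[OF _ squeezing_polydisk_maps_exist[OF assms(1,4) z]])
      from r_in obtain f :: "complex ^ 2 \<Rightarrow> complex ^ 2" where f: "holomorphic_map_on f \<Omega>" "inj_on f \<Omega>"
        "f ` \<Omega> \<subseteq> polydisk 1" "f z = 0" "polydisk r \<subseteq> f ` \<Omega>"
        by blast
      have "injective_holomorphic f \<Omega> r"
        by unfold_locales (use f r assms(1) in auto)
      then have "injective_holomorphic f \<Omega> (98/100)"
        by (rule injective_holomorphic.smaller_polydisk) (use r in auto)
      from injective_holomorphic_affine_pullback[OF lin cl inj this, of q]
      show False
        using t(3)[of "\<lambda>x. f (q + l x)"] f(3,4) by (simp add: \<Omega>'_def z_def)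
    qed
    with \<rho> show ?thesis unfolding levi_flat_at_def by blast
  qed
  then show ?thesis
    using U0(1,2) e(1) by (intro exI[of _ "U0 \<inter> ball p e"]) auto
qed

end
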